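(* Suppose the parameters $m_i$, $i=1,2,\dots$, are chosen so that for all $i\ge 1$ $$\|T-T^{(m_i)}\|\le \frac{a_i}{2},\qquad \|T^{(m_i)}-K_{m_i}^*K\|\le a_i^2,\qquad \|K_{m_i}^*-K^*\|\le \frac{\sqrt{a_i}}{2},\qquad \|Q-Q^{(m_i)}\|\le \epsilon a_i ,$$ where $\epsilon\in(0,1/2]$ is a constant. Let $u_{n,m_n}^\delta$ be defined by $$u_{n,m_n}^\delta=q\,u_{n-1,m_{n-1}}^\delta+(1-q)T_{a_n,m_n}^{-1}K_{m_n}^*f_\delta,\qquad u_{0,m_0}^\delta=0,$$ and let the integer $n_\delta\ge 1$ be chosen by the stopping rule $$G_{n_\delta,m_{n_\delta}}\le C\delta^{\varepsilon}<G_{n,m_n},\quad 1\le n<n_\delta,\qquad C>2,\ \varepsilon\in(0,1).$$ Then $$\lim_{\delta\to0}\|u_{n_\delta,m_{n_\delta}}^\delta-y\|=0.$$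
   Context: $K:L^2[c,d]\to L^2[c,d]$ is the compact linear operator $(Ku)(x)=\int_c^d k(x,z)u(z)\,dz$ with smooth kernel $k$ on $[c,d]\times[c,d]$; $\mathcal N(K)$ is its nullspace and $K^*$ its adjoint. The element $y$ satisfies $Ky=f$ and $y\perp\mathcal N(K)$ (the minimal-norm solution). For each noise level $\delta>0$, $f_\delta\in L^2[c,d]$ satisfies $\|f_\delta-f\|\le\delta$. Norms are the $L^2[c,d]$ norm and the corresponding operator norm. $q\in(0,1)$ and $\alpha_0>0$ are constants, $a_n:=\alpha_0q^n$. $T:=K^*K$, $Q:=KK^*$. For each $m$, $T^{(m)}$, $K_m^*$, $Q^{(m)}$ are finite-rank bounded linear operators on $L^2[c,d]$ approximating $T$, $K^*$, $Q$ respectively, with $\lim_{m\to\infty}\|T^{(m)}-T\|=0$ and $\lim_{m\to\infty}\|K_m^*-K^*\|=0$ ($K_m^*$ is just the notation for the operator approximating $K^*$). $T_{a,m}:=T^{(m)}+aI$ and $Q_{a,m}:=Q^{(m)}+aI$ for $a>0$. For each $\delta$ the sequence $G_{n,m_n}$ is defined by $$G_{n,m_n}=qG_{n-1,m_{n-1}}+(1-q)a_n\|Q_{a_n,m_n}^{-1}f_\delta\|,\quad n\ge1,\qquad G_{0,m_0}=0,$$ and it is assumed as part of the rule that $G_{1,m_1}\ge C\delta^{\varepsilon}$ for every $\delta$ under consideration. The exponent $\varepsilon\in(0,1)$ and the constant $\epsilon\in(0,1/2]$ are different constants. *)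

theory Defs
  imports "HOL-Analysis.Analysis"
begin

text \<open>
  The scalars range over a type of class real-normed field and Euclidean space, that is, over the
  reals or the complex numbers.  \<open>inner\<close> is the real inner product (over the complex numbers: the
  real part of the Hermitian one).  It yields the same norm, the same adjoint of a complex-linear
  operator and the same orthogonal complement of a complex subspace as the Hermitian product.
\<close>

definition square_integrable :: "(real \<Rightarrow> 'a::euclidean_space) \<Rightarrow> bool" where
  "square_integrable f \<longleftrightarrow>
     f \<in> borel_measurable lborel \<and> integrable lborel (\<lambda>x. (norm (f x))\<^sup>2)"

lemma square_integrable_zero: "square_integrable (\<lambda>x. 0)"
  by (simp add: square_integrable_def)

lemma square_integrable_add:
  assumes "square_integrable f" "square_integrable g"
  shows "square_integrable (\<lambda>x. f x + g x)"
proof -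
  have [measurable]: "f \<in> borel_measurable lborel" "g \<in> borel_measurable lborel"
    using assms by (auto simp: square_integrable_def)
  have "integrable lborel (\<lambda>x. (norm (f x + g x))\<^sup>2)"
  proof (rule Bochner_Integration.integrable_bound)
    show "integrable lborel (\<lambda>x. 2 * (norm (f x))\<^sup>2 + 2 * (norm (g x))\<^sup>2)"
      using assms by (auto simp: square_integrable_def)
    have "(norm (f x + g x))\<^sup>2 \<le> 2 * (norm (f x))\<^sup>2 + 2 * (norm (g x))\<^sup>2" for x
    proof -
      have "(norm (f x + g x))\<^sup>2 \<le> (norm (f x) + norm (g x))\<^sup>2"
        by (intro power_mono norm_triangle_ineq) auto
      also have "\<dots> \<le> 2 * (norm (f x))\<^sup>2 + 2 * (norm (g x))\<^sup>2"
        using sum_squares_bound[of "norm (f x)" "norm (g x)"] by (simp add: power2_sum)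
      finally show ?thesis .
    qed
    then show "AE x in lborel. norm ((norm (f x + g x))\<^sup>2)
        \<le> norm (2 * (norm (f x))\<^sup>2 + 2 * (norm (g x))\<^sup>2)"
      by auto
  qed simp
  then show ?thesis by (simp add: square_integrable_def)
qed

lemma square_integrable_scaleR:
  "square_integrable f \<Longrightarrow> square_integrable (\<lambda>x. r *\<^sub>R f x)"
  by (auto simp: square_integrable_def power_mult_distrib)

lemma square_integrable_inner:
  assumes "square_integrable f" "square_integrable g"
  shows "integrable lborel (\<lambda>x. f x \<bullet> g x)"
proof (rule Bochner_Integration.integrable_bound)
  have [measurable]: "f \<in> borel_measurable lborel" "g \<in> borel_measurable lborel"
    using assms by (auto simp: square_integrable_def)
  show "(\<lambda>x. f x \<bullet> g x) \<in> borel_measurable lborel" by measurable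
  show "integrable lborel (\<lambda>x. (norm (f x))\<^sup>2 + (norm (g x))\<^sup>2)"
    using assms by (auto simp: square_integrable_def)
  have "\<bar>f x \<bullet> g x\<bar> \<le> (norm (f x))\<^sup>2 + (norm (g x))\<^sup>2" for x
  proof -
    have "\<bar>f x \<bullet> g x\<bar> \<le> norm (f x) * norm (g x)" by (rule Cauchy_Schwarz_ineq2)
    moreover have "0 \<le> norm (f x) * norm (g x)" by simp
    ultimately show ?thesis
      using sum_squares_bound[of "norm (f x)" "norm (g x)"] by linarith
  qed
  then show "AE x in lborel. norm (f x \<bullet> g x) \<le> norm ((norm (f x))\<^sup>2 + (norm (g x))\<^sup>2)"
    by auto
qed

definition l2_rel :: "(real \<Rightarrow> 'a::euclidean_space) \<Rightarrow> (real \<Rightarrow> 'a) \<Rightarrow> bool" where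
  "l2_rel f g \<longleftrightarrow>
     square_integrable f \<and> square_integrable g \<and> (AE x in lborel. f x = g x)"

text \<open>
  Every Lebesgue measurable function agrees almost everywhere with a Borel measurable one, so
  Borel representatives lose no element of the space.
\<close>

quotient_type (overloaded) 'a l2 = "real \<Rightarrow> 'a::euclidean_space" / partial: l2_rel
proof (rule part_equivpI)
  show "\<exists>x. l2_rel x (x :: real \<Rightarrow> 'a)"
    by (rule exI[of _ "\<lambda>x. 0"]) (simp add: l2_rel_def square_integrable_zero)
  show "symp l2_rel" by (auto simp: symp_def l2_rel_def)
  show "transp l2_rel" by (auto simp: transp_def l2_rel_def elim: eventually_elim2)
qed

instantiation l2 :: (euclidean_space) real_inner
begin

lift_definition zero_l2 :: "'a l2" is "\<lambda>x. 0"
  by (simp add: l2_rel_def square_integrable_zero)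

lift_definition plus_l2 :: "'a l2 \<Rightarrow> 'a l2 \<Rightarrow> 'a l2" is "\<lambda>f g x. f x + g x"
  by (auto simp: l2_rel_def square_integrable_add elim: eventually_elim2)

lift_definition scaleR_l2 :: "real \<Rightarrow> 'a l2 \<Rightarrow> 'a l2" is "\<lambda>r f x. r *\<^sub>R f x"
  by (auto simp: l2_rel_def square_integrable_scaleR)

lift_definition inner_l2 :: "'a l2 \<Rightarrow> 'a l2 \<Rightarrow> real" is
  "\<lambda>f g. integral\<^sup>L lborel (\<lambda>x. f x \<bullet> g x)"
proof -
  fix f f' g g' :: "real \<Rightarrow> 'a"
  assume "l2_rel f f'" "l2_rel g g'"
  then have [measurable]: "f \<in> borel_measurable lborel" "g \<in> borel_measurable lborel"
      "f' \<in> borel_measurable lborel" "g' \<in> borel_measurable lborel"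
    unfolding l2_rel_def square_integrable_def by simp_all
  have ae: "AE x in lborel. f x = f' x" "AE x in lborel. g x = g' x"
    using \<open>l2_rel f f'\<close> \<open>l2_rel g g'\<close> unfolding l2_rel_def by simp_all
  show "integral\<^sup>L lborel (\<lambda>x. f x \<bullet> g x) = integral\<^sup>L lborel (\<lambda>x. f' x \<bullet> g' x)"
    by (rule integral_cong_AE) (use ae in auto)
qed

definition uminus_l2 :: "'a l2 \<Rightarrow> 'a l2" where "uminus_l2 u = (-1) *\<^sub>R u"
definition minus_l2 :: "'a l2 \<Rightarrow> 'a l2 \<Rightarrow> 'a l2" where "minus_l2 u v = u + (- v)"
definition norm_l2 :: "'a l2 \<Rightarrow> real" where "norm_l2 u = sqrt (u \<bullet> u)"
definition dist_l2 :: "'a l2 \<Rightarrow> 'a l2 \<Rightarrow> real" where "dist_l2 u v = norm (u - v)"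
definition sgn_l2 :: "'a l2 \<Rightarrow> 'a l2" where "sgn_l2 u = inverse (norm u) *\<^sub>R u"
definition uniformity_l2 :: "('a l2 \<times> 'a l2) filter" where
  "uniformity_l2 = (INF e\<in>{0<..}. principal {(x, y). dist x y < e})"
definition open_l2 :: "'a l2 set \<Rightarrow> bool" where
  "open_l2 U \<longleftrightarrow> (\<forall>x\<in>U. eventually (\<lambda>(x', y). x' = x \<longrightarrow> y \<in> U) uniformity)"

instance
proof
  fix u v w :: "'a l2" and r s :: real and U :: "'a l2 set"
  show "u + v + w = u + (v + w)"
    by transfer (auto simp: l2_rel_def square_integrable_add add.assoc)
  show "u + v = v + u"
    by transfer (auto simp: l2_rel_def square_integrable_add add.commute)
  show "0 + u = u"
    by transfer (auto simp: l2_rel_def)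
  show "- u + u = 0"
    unfolding uminus_l2_def
    by transfer (auto simp: l2_rel_def square_integrable_zero)
  show "u - v = u + - v" by (simp add: minus_l2_def)
  show "r *\<^sub>R (u + v) = r *\<^sub>R u + r *\<^sub>R v"
    by transfer (auto simp: l2_rel_def square_integrable_add square_integrable_scaleR algebra_simps)
  show "(r + s) *\<^sub>R u = r *\<^sub>R u + s *\<^sub>R u"
    by transfer (auto simp: l2_rel_def square_integrable_add square_integrable_scaleR algebra_simps)
  show "r *\<^sub>R s *\<^sub>R u = (r * s) *\<^sub>R u"
    by transfer (auto simp: l2_rel_def square_integrable_scaleR)
  show "1 *\<^sub>R u = u"
    by transfer (auto simp: l2_rel_def)
  show "u \<bullet> v = v \<bullet> u"
    by transfer (simp add: inner_commute)
  show "(u + v) \<bullet> w = u \<bullet> w + v \<bullet> w"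
    by transfer (simp add: l2_rel_def inner_add_left square_integrable_inner)
  show "(r *\<^sub>R u) \<bullet> v = r * (u \<bullet> v)"
    by transfer simp
  show "0 \<le> u \<bullet> u"
    by transfer simp
  show "(u \<bullet> u = 0) = (u = 0)"
  proof transfer
    fix f :: "real \<Rightarrow> 'a"
    assume "l2_rel f f"
    then have f: "square_integrable f" by (simp add: l2_rel_def)
    then have "(integral\<^sup>L lborel (\<lambda>x. f x \<bullet> f x) = 0) = (AE x in lborel. f x \<bullet> f x = 0)"
      by (intro integral_nonneg_eq_0_iff_AE square_integrable_inner) auto
    then show "(integral\<^sup>L lborel (\<lambda>x. f x \<bullet> f x) = 0) = l2_rel f (\<lambda>x. 0)"
      using f by (simp add: l2_rel_def square_integrable_zero)
  qed
  show "norm u = sqrt (u \<bullet> u)" by (simp add: norm_l2_def)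
  show "dist u v = norm (u - v)" by (simp add: dist_l2_def)
  show "sgn u = inverse (norm u) *\<^sub>R u" by (simp add: sgn_l2_def)
  show "uniformity = (INF e\<in>{0<..}. principal {(x :: 'a l2, y). dist x y < e})"
    by (rule uniformity_l2_def)
  show "open U = (\<forall>x\<in>U. eventually (\<lambda>(x', y). x' = x \<longrightarrow> y \<in> U) uniformity)"
    by (rule open_l2_def)
qed

end

definition l2_of :: "(real \<Rightarrow> 'a::euclidean_space) \<Rightarrow> 'a l2" where
  "l2_of f = abs_l2 f"

definition l2_fun :: "'a::euclidean_space l2 \<Rightarrow> real \<Rightarrow> 'a" where
  "l2_fun u = rep_l2 u"

lemma square_integrable_l2_fun: "square_integrable (l2_fun u)"
  using Quotient_rep_reflp[OF Quotient_l2, of u] by (simp add: l2_fun_def l2_rel_def)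

lemma l2_of_l2_fun: "l2_of (l2_fun u) = u"
  by (simp add: l2_of_def l2_fun_def Quotient_abs_rep[OF Quotient_l2])

lemma l2_fun_l2_of:
  assumes "square_integrable f"
  shows "AE x in lborel. l2_fun (l2_of f) x = f x"
  using Quotient_rep_abs[OF Quotient_l2, of f] assms
  by (simp add: l2_fun_def l2_of_def l2_rel_def)

lemma inner_l2_eq: "u \<bullet> v = integral\<^sup>L lborel (\<lambda>x. l2_fun u x \<bullet> l2_fun v x)"
  by (simp add: inner_l2.rep_eq l2_fun_def)

text \<open>The space \<open>L\<^sup>2[c,d]\<close>, embedded in \<open>L\<^sup>2\<close> of the line by extension by zero.\<close>

definition L2 :: "real \<Rightarrow> real \<Rightarrow> 'a::euclidean_space l2 set" where
  "L2 c d = {u. AE x in lborel. x \<notin> {c..d} \<longrightarrow> l2_fun u x = 0}"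

text \<open>
  Linearity is over the reals; for complex scalars every complex-linear operator is covered, and
  finite rank over the complex numbers is the same as finite rank over the reals.
\<close>

definition bounded_linear_op_on ::
    "'v::real_normed_vector set \<Rightarrow> ('v \<Rightarrow> 'v) \<Rightarrow> bool" where
  "bounded_linear_op_on S A \<longleftrightarrow>
     A \<in> S \<rightarrow> S \<and>
     (\<forall>u\<in>S. \<forall>v\<in>S. A (u + v) = A u + A v) \<and>
     (\<forall>r. \<forall>u\<in>S. A (r *\<^sub>R u) = r *\<^sub>R A u) \<and>
     (\<exists>B. \<forall>u\<in>S. norm (A u) \<le> B * norm u)"

definition finite_rank_on ::
    "'v::real_normed_vector set \<Rightarrow> ('v \<Rightarrow> 'v) \<Rightarrow> bool" where
  "finite_rank_on S A \<longleftrightarrow> (\<exists>B. finite B \<and> A ` S \<subseteq> span B)"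

definition opnorm_on :: "'v::real_normed_vector set \<Rightarrow> ('v \<Rightarrow> 'v) \<Rightarrow> real" where
  "opnorm_on S A = (SUP u\<in>{u \<in> S. norm u \<le> 1}. norm (A u))"

definition adjoint_on :: "'v::real_inner set \<Rightarrow> ('v \<Rightarrow> 'v) \<Rightarrow> 'v \<Rightarrow> 'v" where
  "adjoint_on S A v = (THE w. w \<in> S \<and> (\<forall>u\<in>S. A u \<bullet> v = u \<bullet> w))"

definition nullspace_on :: "'v::real_vector set \<Rightarrow> ('v \<Rightarrow> 'v) \<Rightarrow> 'v set" where
  "nullspace_on S A = {u \<in> S. A u = 0}"

text \<open>
  The resolvent-type inverse \<open>(A + a I)\<^sup>-\<^sup>1\<close> of an operator on \<open>S\<close>; meaningful when \<open>A + a I\<close>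
  is a bijection of \<open>S\<close>.
\<close>

definition shifted_inv_on ::
    "'v::real_vector set \<Rightarrow> ('v \<Rightarrow> 'v) \<Rightarrow> real \<Rightarrow> 'v \<Rightarrow> 'v" where
  "shifted_inv_on S A a = inv_into S (\<lambda>u. A u + a *\<^sub>R u)"

text \<open>
  \<open>C\<^sup>\<infinity>\<close> on the closed square: \<open>D i j\<close> is the partial derivative of order \<open>i\<close> in the first and \<open>j\<close>
  in the second variable, one-sided on the boundary.
\<close>

definition smooth_kernel ::
    "real \<Rightarrow> real \<Rightarrow> (real \<Rightarrow> real \<Rightarrow> 'a::real_normed_vector) \<Rightarrow> bool" where
  "smooth_kernel c d k \<longleftrightarrow>
     (\<exists>D :: nat \<Rightarrow> nat \<Rightarrow> real \<Rightarrow> real \<Rightarrow> 'a.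
        D 0 0 = k \<and>
        (\<forall>i j. continuous_on ({c..d} \<times> {c..d}) (\<lambda>(x, z). D i j x z) \<and>
           (\<forall>x\<in>{c..d}. \<forall>z\<in>{c..d}.
              ((\<lambda>s. D i j s z) has_vector_derivative D (Suc i) j x z) (at x within {c..d}) \<and>
              ((\<lambda>t. D i j x t) has_vector_derivative D i (Suc j) x z) (at z within {c..d}))))"

text \<open>
  For a kernel continuous on the square the function below is square integrable, and changing the
  representative of \<open>u\<close> on a null set does not affect it.
\<close>

definition integral_op ::
    "real \<Rightarrow> real \<Rightarrow> (real \<Rightarrow> real \<Rightarrow> 'a::{real_normed_field,euclidean_space})
      \<Rightarrow> 'a l2 \<Rightarrow> 'a l2" where
  "integral_op c d k u =
     l2_of (\<lambda>x. indicat_real {c..d} x *\<^sub>R (LINT z:{c..d}|lborel. k x z * l2_fun u z))"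

end

theory Submission
  imports Defs
begin

text \<open>
  Put \<open>p = sqrt q\<close>, so that \<open>sqrt a\<^sub>n\<close> is a constant times \<open>p\<^sup>n\<close>.  Both \<open>u\<^sub>n\<close> and \<open>G\<^sub>n\<close> are averages
  with weights \<open>(1 - q) q\<^bsup>n-j\<^esup>\<close>, of the regularised solutions \<open>w\<^sub>j = (T\<^sub>m + a\<^sub>j)\<^sup>-\<^sup>1 K\<^sub>m f\<^sub>\<delta>\<close> and of the
  residual norms \<open>a\<^sub>j \<parallel>(Q\<^sub>m + a\<^sub>j)\<^sup>-\<^sup>1 f\<^sub>\<delta>\<parallel>\<close> respectively.  Such an average preserves the order of growth
  of a bound \<open>E + M p\<^sup>j + N / p\<^sup>j\<close> on its terms (\<open>geometric_average_bound\<close>), because the weights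
  decay like \<open>p\<^bsup>2(n-j)\<^esup>\<close>; so it suffices to estimate one step at a time.

  One step.  The operator \<open>T = K\<^sup>*K\<close> is positive and \<open>T\<^sub>m\<close> is within \<open>a\<^sub>j / 2\<close> of it, so the quadratic
  form of \<open>T\<^sub>m + a\<^sub>j\<close> dominates the form of \<open>T + a\<^sub>j / 2\<close>.  This replaces the spectral theorem
  throughout: it makes \<open>T\<^sub>m + a\<^sub>j\<close> injective, hence bijective as \<open>T\<^sub>m\<close> has finite rank, bounds its
  inverse by \<open>2 / a\<^sub>j\<close>, and bounds \<open>(T\<^sub>m + a\<^sub>j)\<^sup>-\<^sup>1 K\<^sup>*\<close> by \<open>1 / sqrt a\<^sub>j\<close>.  The data noise therefore
  contributes \<open>O(\<delta> / sqrt a\<^sub>j)\<close> to \<open>w\<^sub>j - y\<close>.  The bias is treated by comparing \<open>y\<close> with \<open>T z\<close> for an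
  arbitrary \<open>z\<close>: it is at most \<open>2 \<parallel>y - T z\<parallel> + O\<^sub>z(a\<^sub>j)\<close> (\<open>perturbed_tikhonov_error\<close>).  As \<open>y\<close> is
  orthogonal to the nullspace of \<open>K\<close>, it lies in the closure of the range of \<open>T\<close>, so the first
  summand is as small as desired (\<open>orthogonal_to_nullspace_approx\<close>).  The same argument for \<open>Q\<close> gives
  \<open>G\<^sub>n \<le> 2 \<delta> + O(sqrt a\<^sub>n)\<close> (\<open>perturbed_residual_bound\<close>).

  Stopping.  What remains is that \<open>\<delta> / sqrt a\<^sub>n \<rightarrow> 0\<close> and \<open>a\<^sub>n \<rightarrow> 0\<close> at \<open>n = n\<^sub>\<delta>\<close>.  One step before stopping
  \<open>G\<close> still exceeds \<open>C \<delta>\<^sup>\<theta>\<close> (when the rule stops at once, \<open>G\<^sub>1\<close> is at least that by assumption), and \<open>C > 2\<close> absorbs the term \<open>2 \<delta>\<close> of the upper bound, so that \<open>\<delta>\<^sup>\<theta>\<close> is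
  at most a constant times \<open>sqrt a\<^sub>n\<close>; as \<open>\<theta> < 1\<close>, this gives the first limit.  If \<open>y \<noteq> 0\<close> then
  \<open>f \<noteq> 0\<close>, so \<open>G\<^sub>1\<close> stays away from \<open>0\<close> as \<open>\<delta> \<rightarrow> 0\<close>; as \<open>G\<close> loses at most a factor \<open>q\<close> per step, getting
  down to \<open>C \<delta>\<^sup>\<theta>\<close> takes more and more steps, which gives the second limit.  If \<open>y = 0\<close> the bias
  vanishes and the first limit suffices.

  The analytic input is that \<open>L\<^sup>2[c,d]\<close> is complete.  Completeness yields the adjoint of \<open>K\<close> and the
  approximation of \<open>y\<close>, both through the Riesz representation theorem.
\<close>

section \<open>Bounded operators on complete subspaces\<close>

text \<open>
  The representer is the limit of a minimising sequence of \<open>J u = \<parallel>u\<parallel>\<^sup>2 - 2 \<phi> u\<close>.  The parallelogram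
  law makes such a sequence Cauchy, and minimality along the line through \<open>s\<^sub>n\<close> in direction \<open>v\<close>
  forces \<open>\<langle>v, s\<^sub>n\<rangle> - \<phi> v \<rightarrow> 0\<close>.
\<close>

lemma riesz_representation:
  fixes S :: "'v::real_inner set"
  assumes S: "subspace S" "complete S"
    and add: "\<And>u v. u \<in> S \<Longrightarrow> v \<in> S \<Longrightarrow> \<phi> (u + v) = \<phi> u + \<phi> v"
    and scale: "\<And>r u. u \<in> S \<Longrightarrow> \<phi> (r *\<^sub>R u) = r * \<phi> u"
    and bound: "\<And>u. u \<in> S \<Longrightarrow> \<bar>\<phi> u\<bar> \<le> B * norm u"
  obtains w where "w \<in> S" "\<And>v. v \<in> S \<Longrightarrow> \<phi> v = v \<bullet> w"
proof -
  define J where "J u = (norm u)\<^sup>2 - 2 * \<phi> u" for u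
  define \<mu> where "\<mu> = Inf (J ` S)"
  have J_ge: "- B\<^sup>2 \<le> J u" if "u \<in> S" for u
  proof -
    have "0 \<le> (norm u - B)\<^sup>2" by simp
    then show ?thesis using bound[OF that] by (simp add: J_def power2_diff algebra_simps)
  qed
  have bdd: "bdd_below (J ` S)" using J_ge by (auto simp: bdd_below_def)
  have ne: "J ` S \<noteq> {}" using S(1) subspace_0 by blast
  have \<mu>_le: "\<mu> \<le> J u" if "u \<in> S" for u
    unfolding \<mu>_def using that bdd by (intro cInf_lower) auto
  have "\<exists>u\<in>S. J u < \<mu> + inverse (Suc n)" for n
    using cInf_lessD[OF ne, of "\<mu> + inverse (Suc n)"] unfolding \<mu>_def by fastforce
  then obtain s where s: "\<And>n. s n \<in> S" "\<And>n. J (s n) < \<mu> + inverse (Suc n)" by metis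
  have mid: "(norm (s n - s k))\<^sup>2 < 2 * inverse (Suc n) + 2 * inverse (Suc k)" for n k
  proof -
    let ?h = "(1/2) *\<^sub>R (s n + s k)"
    have sum: "s n + s k \<in> S" using s S(1) by (simp add: subspace_add)
    have "?h \<in> S" using sum S(1) by (simp add: subspace_scale)
    then have "\<mu> \<le> J ?h" by (rule \<mu>_le)
    moreover have "(norm (s n - s k))\<^sup>2 = 2 * J (s n) + 2 * J (s k) - 4 * J ?h"
      unfolding J_def scale[OF sum] add[OF s(1) s(1)]
      by (simp add: power2_norm_eq_inner inner_add inner_diff inner_commute algebra_simps)
    ultimately show ?thesis using s(2)[of n] s(2)[of k] by linarith
  qed
  have "Cauchy s"
  proof (rule metric_CauchyI)
    fix e :: real assume "e > 0"
    then obtain N where N: "inverse (Suc N) < e\<^sup>2 / 4"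
      using reals_Archimedean[of "e\<^sup>2 / 4"] by auto
    have "dist (s n) (s k) < e" if "n \<ge> N" "k \<ge> N" for n k
    proof -
      have "inverse (real (Suc n)) \<le> inverse (Suc N)" "inverse (real (Suc k)) \<le> inverse (Suc N)"
        using that by (simp_all add: field_simps)
      then have "(norm (s n - s k))\<^sup>2 < e\<^sup>2" using mid[of n k] N by linarith
      then show ?thesis using \<open>e > 0\<close> by (simp add: dist_norm power2_less_imp_less)
    qed
    then show "\<exists>M. \<forall>m\<ge>M. \<forall>n\<ge>M. dist (s m) (s n) < e" by blast
  qed
  then obtain w where w: "w \<in> S" "s \<longlonglongrightarrow> w"
    using S(2) s(1) unfolding complete_def by blast
  have "\<phi> v = v \<bullet> w" if v: "v \<in> S" for v
  proof (cases "v = 0")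
    case True
    then show ?thesis using scale[OF v, of 0] by simp
  next
    case False
    define D where "D n = v \<bullet> s n - \<phi> v" for n
    have Dsq: "(D n)\<^sup>2 \<le> (norm v)\<^sup>2 * inverse (Suc n)" for n
    proof -
      \<comment> \<open>The minimiser of the quadratic function \<open>t \<mapsto> J (s n + t *\<^sub>R v)\<close>.\<close>
      define t where "t = - D n / (norm v)\<^sup>2"
      have "t *\<^sub>R v \<in> S" using v S(1) by (simp add: subspace_scale)
      then have "\<mu> \<le> J (s n + t *\<^sub>R v)" by (intro \<mu>_le subspace_add S(1) s)
      also have "J (s n + t *\<^sub>R v) = J (s n) + (2 * t * D n + t\<^sup>2 * (norm v)\<^sup>2)"
        unfolding J_def D_def power2_norm_eq_inner
        using add[OF s(1) \<open>t *\<^sub>R v \<in> S\<close>] scale[OF v]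
        by (simp add: inner_add inner_commute power2_eq_square algebra_simps)
      also have "2 * t * D n + t\<^sup>2 * (norm v)\<^sup>2 = - (D n)\<^sup>2 / (norm v)\<^sup>2"
        using False by (simp add: t_def field_simps power2_eq_square)
      finally have "(D n)\<^sup>2 / (norm v)\<^sup>2 \<le> inverse (Suc n)" using s(2)[of n]
        by simp
      then show ?thesis using False by (simp add: divide_le_eq mult.commute)
    qed
    have "(\<lambda>n. (norm v)\<^sup>2 * inverse (real (Suc n))) \<longlonglongrightarrow> (norm v)\<^sup>2 * 0"
        by (rule tendsto_mult[OF tendsto_const LIMSEQ_inverse_real_of_nat])
    then have lim: "(\<lambda>n. (norm v)\<^sup>2 * inverse (real (Suc n))) \<longlonglongrightarrow> 0"
      by (simp only: mult_zero_right)
    have "(\<lambda>n. (D n)\<^sup>2) \<longlonglongrightarrow> 0"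
      by (rule tendsto_sandwich[OF _ _ tendsto_const lim])
        (intro always_eventually allI Dsq zero_le_power2)+
    moreover have "(\<lambda>n. (D n)\<^sup>2) \<longlonglongrightarrow> (v \<bullet> w - \<phi> v)\<^sup>2"
      unfolding D_def by (intro tendsto_intros w)
    ultimately have "(v \<bullet> w - \<phi> v)\<^sup>2 = 0" using LIMSEQ_unique by blast
    then show ?thesis by simp
  qed
  with w show ?thesis using that by blast
qed

lemma bounded_linear_op_onD:
  assumes "bounded_linear_op_on S A"
  shows "u \<in> S \<Longrightarrow> A u \<in> S"
    and "u \<in> S \<Longrightarrow> v \<in> S \<Longrightarrow> A (u + v) = A u + A v"
    and "u \<in> S \<Longrightarrow> A (r *\<^sub>R u) = r *\<^sub>R A u"
  using assms by (auto simp: bounded_linear_op_on_def)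

lemma bounded_linear_op_on_diff:
  assumes "bounded_linear_op_on S A" "subspace S" "u \<in> S" "v \<in> S"
  shows "A (u - v) = A u - A v"
proof -
  have "(-1) *\<^sub>R v \<in> S" using assms by (simp only: subspace_scale)
  then have "A (u + (-1) *\<^sub>R v) = A u + (-1) *\<^sub>R A v"
    using assms bounded_linear_op_onD by metis
  then show ?thesis by simp
qed

lemma bounded_linear_op_on_bound:
  assumes "bounded_linear_op_on S A"
  obtains B where "B > 0" "\<And>u. u \<in> S \<Longrightarrow> norm (A u) \<le> B * norm u"
proof -
  obtain B where B: "\<forall>u\<in>S. norm (A u) \<le> B * norm u"
    using assms by (auto simp: bounded_linear_op_on_def)
  have "norm (A u) \<le> (\<bar>B\<bar> + 1) * norm u" if "u \<in> S" for u
  proof -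
    have "norm (A u) \<le> B * norm u" using B that by blast
    also have "\<dots> \<le> (\<bar>B\<bar> + 1) * norm u" by (intro mult_right_mono) auto
    finally show ?thesis .
  qed
  then show ?thesis using that[of "\<bar>B\<bar> + 1"] by auto
qed

lemma bounded_linear_op_on_compose:
  assumes A: "bounded_linear_op_on S A" and B: "bounded_linear_op_on S B"
  shows "bounded_linear_op_on S (\<lambda>v. A (B v))"
proof -
  obtain a where a: "a > 0" "\<And>u. u \<in> S \<Longrightarrow> norm (A u) \<le> a * norm u"
    using bounded_linear_op_on_bound[OF A] by blast
  obtain b where b: "b > 0" "\<And>u. u \<in> S \<Longrightarrow> norm (B u) \<le> b * norm u"
    using bounded_linear_op_on_bound[OF B] by blast
  have "norm (A (B u)) \<le> (a * b) * norm u" if "u \<in> S" for u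
  proof -
    have "norm (A (B u)) \<le> a * norm (B u)" using a bounded_linear_op_onD(1)[OF B] that by blast
    also have "\<dots> \<le> a * (b * norm u)" using a b that by (intro mult_left_mono) auto
    finally show ?thesis by (simp add: mult.assoc)
  qed
  then show ?thesis unfolding bounded_linear_op_on_def
    using bounded_linear_op_onD[OF A] bounded_linear_op_onD[OF B] by auto
qed

lemma bounded_linear_op_on_minus:
  assumes S: "subspace S" and A: "bounded_linear_op_on S A" and B: "bounded_linear_op_on S B"
  shows "bounded_linear_op_on S (\<lambda>v. A v - B v)"
proof -
  obtain a where a: "a > 0" "\<And>u. u \<in> S \<Longrightarrow> norm (A u) \<le> a * norm u"
    using bounded_linear_op_on_bound[OF A] by blast
  obtain b where b: "b > 0" "\<And>u. u \<in> S \<Longrightarrow> norm (B u) \<le> b * norm u"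
    using bounded_linear_op_on_bound[OF B] by blast
  have "norm (A u - B u) \<le> (a + b) * norm u" if "u \<in> S" for u
    using a(2)[OF that] b(2)[OF that] norm_triangle_ineq4[of "A u" "B u"]
    by (simp add: distrib_right)
  then show ?thesis unfolding bounded_linear_op_on_def
    using bounded_linear_op_onD[OF A] bounded_linear_op_onD[OF B]
    by (auto simp: subspace_diff[OF S] scaleR_diff_right)
qed

lemma opnorm_on_bound:
  assumes S: "subspace S" and A: "bounded_linear_op_on S A"
    and le: "opnorm_on S A \<le> b" and u: "u \<in> S"
  shows "norm (A u) \<le> b * norm u"
proof (cases "u = 0")
  case True
  then show ?thesis using bounded_linear_op_onD(3)[OF A u, of 0] by simp
next
  case False
  obtain B where B: "B > 0" "\<And>u. u \<in> S \<Longrightarrow> norm (A u) \<le> B * norm u"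
    using bounded_linear_op_on_bound[OF A] by blast
  have "norm (A v) \<le> B" if "v \<in> S" "norm v \<le> 1" for v
    using order_trans[OF B(2)[OF that(1)]] mult_left_mono[OF that(2), of B] B(1) by simp
  then have bdd: "bdd_above ((\<lambda>v. norm (A v)) ` {u \<in> S. norm u \<le> 1})"
    by (auto simp: bdd_above_def)
  let ?v = "inverse (norm u) *\<^sub>R u"
  have "?v \<in> {u \<in> S. norm u \<le> 1}" using u S False by (simp add: subspace_scale)
  then have "norm (A ?v) \<le> opnorm_on S A"
    unfolding opnorm_on_def using bdd by (rule cSUP_upper)
  then have "inverse (norm u) * norm (A u) \<le> b"
    using le bounded_linear_op_onD(3)[OF A u] by simp
  then show ?thesis using False by (simp add: field_simps)
qed

lemma eq_if_inner_eq_on_subspace: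
  fixes S :: "'v::real_inner set"
  assumes "subspace S" "x \<in> S" "y \<in> S" "\<And>u. u \<in> S \<Longrightarrow> u \<bullet> x = u \<bullet> y"
  shows "x = y"
proof -
  have "x - y \<in> S" using assms(1-3) by (rule subspace_diff)
  then have "(x - y) \<bullet> x = (x - y) \<bullet> y" by (rule assms(4))
  then have "(x - y) \<bullet> (x - y) = 0" by (simp only: inner_diff_right[of "x - y"] diff_self)
  then show ?thesis by simp
qed

text \<open>
  The adjoint is given by a definite description; the Riesz representation theorem supplies the
  existence and pairing with the difference of two candidates their equality.
\<close>

lemma adjoint_on_props:
  assumes S: "subspace S" "complete S" and A: "bounded_linear_op_on S A" and v: "v \<in> S"
  shows adjoint_on_in: "adjoint_on S A v \<in> S"
    and adjoint_on_inner: "u \<in> S \<Longrightarrow> A u \<bullet> v = u \<bullet> adjoint_on S A v"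
proof -
  obtain B where B: "B > 0" "\<And>u. u \<in> S \<Longrightarrow> norm (A u) \<le> B * norm u"
    using bounded_linear_op_on_bound[OF A] by blast
  have "\<bar>A u \<bullet> v\<bar> \<le> (B * norm v) * norm u" if "u \<in> S" for u
  proof -
    have "\<bar>A u \<bullet> v\<bar> \<le> norm (A u) * norm v" by (rule Cauchy_Schwarz_ineq2)
    also have "\<dots> \<le> (B * norm u) * norm v" using B that by (intro mult_right_mono) auto
    finally show ?thesis by (simp add: algebra_simps)
  qed
  moreover have "A (u + u') \<bullet> v = A u \<bullet> v + A u' \<bullet> v" if "u \<in> S" "u' \<in> S" for u u'
    using bounded_linear_op_onD(2)[OF A that] by (simp only: inner_add_left)
  moreover have "A (r *\<^sub>R u) \<bullet> v = r * (A u \<bullet> v)" if "u \<in> S" for r u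
    using bounded_linear_op_onD(3)[OF A that] by (simp only: inner_scaleR_left)
  ultimately obtain w where w: "w \<in> S" "\<And>u. u \<in> S \<Longrightarrow> A u \<bullet> v = u \<bullet> w"
    using riesz_representation[OF S, of "\<lambda>u. A u \<bullet> v" "B * norm v"] by blast
  have "w' = w" if w': "w' \<in> S" "\<forall>u\<in>S. A u \<bullet> v = u \<bullet> w'" for w'
  proof (rule eq_if_inner_eq_on_subspace[OF S(1) w'(1) w(1)])
    show "u \<bullet> w' = u \<bullet> w" if "u \<in> S" for u using w'(2) w(2) that by metis
  qed
  then have eq: "adjoint_on S A v = w"
    unfolding adjoint_on_def using w by (intro the_equality) blast+
  show "adjoint_on S A v \<in> S" unfolding eq by (rule w(1))
  show "u \<in> S \<Longrightarrow> A u \<bullet> v = u \<bullet> adjoint_on S A v" unfolding eq by (rule w(2))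
qed

lemma bounded_linear_op_on_adjoint:
  assumes S: "subspace S" "complete S" and A: "bounded_linear_op_on S A"
  shows "bounded_linear_op_on S (adjoint_on S A)"
proof -
  note P = adjoint_on_props[OF S A]
  obtain B where B: "B > 0" "\<And>u. u \<in> S \<Longrightarrow> norm (A u) \<le> B * norm u"
    using bounded_linear_op_on_bound[OF A] by blast
  have "norm (adjoint_on S A v) \<le> B * norm v" if v: "v \<in> S" for v
  proof (cases "adjoint_on S A v = 0")
    case True then show ?thesis using B by simp
  next
    case False
    let ?w = "adjoint_on S A v"
    have "norm ?w * norm ?w = A ?w \<bullet> v"
      using P(2)[OF v P(1)[OF v]] by (simp only: power2_norm_eq_inner flip: power2_eq_square)
    also have "\<dots> \<le> norm (A ?w) * norm v" by (rule norm_cauchy_schwarz)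
    also have "\<dots> \<le> (B * norm ?w) * norm v" using B P(1)[OF v] by (intro mult_right_mono) auto
    finally have "norm ?w * norm ?w \<le> norm ?w * (B * norm v)" by (simp add: algebra_simps)
    then show ?thesis using False by simp
  qed
  moreover have "adjoint_on S A (v + w) = adjoint_on S A v + adjoint_on S A w"
    if v: "v \<in> S" and w: "w \<in> S" for v w
  proof (rule eq_if_inner_eq_on_subspace[OF S(1)])
    have vw: "v + w \<in> S" using v w by (rule subspace_add[OF S(1)])
    show "adjoint_on S A (v + w) \<in> S" using vw by (rule P(1))
    show "adjoint_on S A v + adjoint_on S A w \<in> S"
      by (intro subspace_add[OF S(1)] P(1) v w)
    show "u \<bullet> adjoint_on S A (v + w) = u \<bullet> (adjoint_on S A v + adjoint_on S A w)"
      if u: "u \<in> S" for u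
      using P(2)[OF vw u] P(2)[OF v u] P(2)[OF w u] by (simp only: inner_add_right)
  qed
  moreover have "adjoint_on S A (r *\<^sub>R v) = r *\<^sub>R adjoint_on S A v" if v: "v \<in> S" for r v
  proof (rule eq_if_inner_eq_on_subspace[OF S(1)])
    have rv: "r *\<^sub>R v \<in> S" using v by (rule subspace_scale[OF S(1)])
    show "adjoint_on S A (r *\<^sub>R v) \<in> S" using rv by (rule P(1))
    show "r *\<^sub>R adjoint_on S A v \<in> S" by (intro subspace_scale[OF S(1)] P(1) v)
    show "u \<bullet> adjoint_on S A (r *\<^sub>R v) = u \<bullet> (r *\<^sub>R adjoint_on S A v)" if u: "u \<in> S" for u
      using P(2)[OF rv u] P(2)[OF v u] by (simp only: inner_scaleR_right)
  qed
  ultimately show ?thesis unfolding bounded_linear_op_on_def using P(1) by (intro conjI) blast+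
qed

lemma subspace_closure:
  fixes S :: "'v::real_normed_vector set"
  assumes "subspace S"
  shows "subspace (closure S)"
proof (rule subspaceI)
  show "0 \<in> closure S" using subspace_0[OF assms] closure_subset by blast
  show "x + y \<in> closure S" if x: "x \<in> closure S" and y: "y \<in> closure S" for x y
  proof -
    obtain s where "\<forall>n. s n \<in> S" "s \<longlonglongrightarrow> x"
      using x unfolding closure_sequential by blast
    moreover obtain t where "\<forall>n. t n \<in> S" "t \<longlonglongrightarrow> y"
      using y unfolding closure_sequential by blast
    ultimately have "\<forall>n. s n + t n \<in> S" "(\<lambda>n. s n + t n) \<longlonglongrightarrow> x + y"
      using subspace_add[OF assms] tendsto_add by blast+
    then show ?thesis unfolding closure_sequential 
      by (intro exI[of _ "\<lambda>n. s n + t n"] conjI)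
  qed
  show "r *\<^sub>R x \<in> closure S" if x: "x \<in> closure S" for r x
  proof -
    obtain s where "\<forall>n. s n \<in> S" "s \<longlonglongrightarrow> x"
      using x unfolding closure_sequential by blast
    then have "\<forall>n. r *\<^sub>R s n \<in> S" "(\<lambda>n. r *\<^sub>R s n) \<longlonglongrightarrow> r *\<^sub>R x"
      using subspace_scale[OF assms] tendsto_scaleR[OF tendsto_const] by blast+
    then show ?thesis unfolding closure_sequential 
      by (intro exI[of _ "\<lambda>n. r *\<^sub>R s n"] conjI)
  qed
qed

text \<open>
  Riesz representation on the closure of the range of \<open>A\<^sup>*A\<close> produces the orthogonal projection \<open>p\<close>
  of \<open>y\<close>.  The remainder \<open>r = y - p\<close> satisfies \<open>\<parallel>A r\<parallel>\<^sup>2 = \<langle>r, A\<^sup>*A r\<rangle> = 0\<close>, so it lies in the nullspace, to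
  which \<open>y\<close> is orthogonal; hence \<open>r\<close> is orthogonal to both \<open>y\<close> and \<open>p\<close>, that is, to itself.
\<close>

lemma orthogonal_to_nullspace_approx:
  fixes S :: "'v::real_inner set"
  assumes S: "subspace S" "complete S" and A: "bounded_linear_op_on S A"
    and y: "y \<in> S" "\<forall>v \<in> nullspace_on S A. y \<bullet> v = 0" and e: "e > 0"
  obtains z where "z \<in> S" "norm (y - adjoint_on S A (A z)) < e"
proof -
  define T where "T = (\<lambda>v. adjoint_on S A (A v))"
  have T: "bounded_linear_op_on S T"
    unfolding T_def
    by (rule bounded_linear_op_on_compose[OF bounded_linear_op_on_adjoint[OF S A] A])
  note TD = bounded_linear_op_onD[OF T] bounded_linear_op_on_diff[OF T S(1)]
  define R where "R = closure (T ` S)"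
  have "subspace (T ` S)"
  proof (rule subspaceI)
    show "0 \<in> T ` S" using TD(3)[OF y(1), of 0] subspace_0[OF S(1)] by (auto intro!: rev_image_eqI)
    show "x + x' \<in> T ` S" if "x \<in> T ` S" "x' \<in> T ` S" for x x'
      using that TD(2)[symmetric] subspace_add[OF S(1)] by auto
    show "r *\<^sub>R x \<in> T ` S" if "x \<in> T ` S" for r x
      using that TD(3)[symmetric] subspace_scale[OF S(1)] by auto
  qed
  then have R: "subspace R" unfolding R_def by (rule subspace_closure)
  have "R \<subseteq> S" unfolding R_def using complete_imp_closed[OF S(2)] TD(1)
    by (intro closure_minimal) auto
  then have "complete R"
    using complete_Int_closed[OF S(2), of R] by (simp add: R_def Int_absorb1)
  obtain p where p: "p \<in> R" "\<And>v. v \<in> R \<Longrightarrow> y \<bullet> v = v \<bullet> p"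
    by (rule riesz_representation[OF R \<open>complete R\<close>, of "\<lambda>v. y \<bullet> v" "norm y"])
      (simp_all only: inner_add_right inner_scaleR_right Cauchy_Schwarz_ineq2)
  define r where "r = y - p"
  have "r \<in> S" unfolding r_def using p(1) \<open>R \<subseteq> S\<close> y(1) subspace_diff[OF S(1)] by blast
  have perp: "r \<bullet> v = 0" if "v \<in> R" for v
    by (simp only: r_def inner_diff_left inner_commute[of p v] p(2)[OF that] diff_self)
  have "T r \<in> R"
    unfolding R_def using \<open>r \<in> S\<close> by (intro subsetD[OF closure_subset] imageI)
  moreover have "A r \<bullet> A r = r \<bullet> T r"
    unfolding T_def using \<open>r \<in> S\<close> bounded_linear_op_onD(1)[OF A] by (intro adjoint_on_inner[OF S A])
  ultimately have "A r \<bullet> A r = 0" using perp by metis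
  then have "r \<in> nullspace_on S A" using \<open>r \<in> S\<close> by (simp add: nullspace_on_def)
  then have "y \<bullet> r = 0" using y(2) by blast
  moreover have "p \<bullet> r = 0" using perp[OF p(1)] by (simp only: inner_commute)
  ultimately have "r \<bullet> r = 0" by (simp add: r_def inner_diff_left)
  then have "y \<in> R" using p(1) by (simp add: r_def)
  then obtain x where "x \<in> T ` S" "dist x y < e"
    using e unfolding R_def closure_approachable by blast
  then obtain z where "z \<in> S" "norm (y - T z) < e" by (auto simp: dist_norm norm_minus_commute)
  then show ?thesis using that unfolding T_def by blast
qed

section \<open>Regularised equations with perturbed operators\<close>

text \<open>
  A perturbation of relative size \<open>1/2\<close> in the shift \<open>a\<close> costs half of the coercivity that \<open>a\<close>
  provides, and keeps the whole form of \<open>P\<close>.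
\<close>

lemma shifted_form_coercive:
  assumes "norm (P x - A x) \<le> (a / 2) * norm x"
  shows "P x \<bullet> x + (a / 2) * (norm x)\<^sup>2 \<le> (A x + a *\<^sub>R x) \<bullet> x"
proof -
  have "(P x - A x) \<bullet> x \<le> norm (P x - A x) * norm x" by (rule norm_cauchy_schwarz)
  also have "\<dots> \<le> ((a / 2) * norm x) * norm x" using assms by (intro mult_right_mono) auto
  finally show ?thesis
    by (simp add: inner_diff_left inner_add_left power2_norm_eq_inner[symmetric] power2_eq_square)
qed

text \<open>
  The equation reduces to the finite-dimensional span \<open>W\<close> of the range of \<open>A\<close>: the ansatz
  \<open>x = (v - w) / a\<close> solves it iff \<open>w \<in> W\<close> satisfies \<open>A w + a w = A v\<close>, and on \<open>W\<close> an injective linear map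
  is surjective.  As \<open>A\<close> is linear on \<open>S\<close> only, it is replaced there by a linear map \<open>g\<close> of the whole
  space that agrees with it on \<open>W\<close>.
\<close>

lemma shifted_finite_rank_surj:
  assumes S: "subspace S" and A: "bounded_linear_op_on S A" and fin: "finite_rank_on S A"
    and a: "a \<noteq> 0"
    and inj: "\<And>x. x \<in> S \<Longrightarrow> A x + a *\<^sub>R x = 0 \<Longrightarrow> x = 0"
    and v: "v \<in> S"
  shows "\<exists>x\<in>S. A x + a *\<^sub>R x = v"
proof -
  note AD = bounded_linear_op_onD[OF A]
  obtain F where F: "finite F" "A ` S \<subseteq> span F" using fin by (auto simp: finite_rank_on_def)
  obtain b where b: "b \<subseteq> A ` S" "independent b" "A ` S \<subseteq> span b"
    by (rule basis_exists[of "A ` S"])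
  have "finite b" using independent_span_bound[OF F(1) b(2)] b(1) F(2) by blast
  have bS: "b \<subseteq> S" using b(1) AD(1) by blast
  then have spanS: "span b \<subseteq> S" using S by (rule span_minimal)
  obtain g where g: "linear g" "\<And>x. x \<in> b \<Longrightarrow> g x = A x"
    using linear_independent_extend[OF b(2), of A] by blast
  have gA: "g x = A x" if "x \<in> span b" for x
  proof -
    have "x \<in> S \<and> g x = A x"
      using that
    proof (induction rule: span_induct_alt)
      case base
      then show ?case using AD(3)[OF v, of 0] subspace_0[OF S] linear_0[OF g(1)] by simp
    next
      case (step c x y)
      then have "x \<in> S" using bS by blast
      then show ?case using step g AD subspace_add[OF S] subspace_scale[OF S]
        by (simp add: linear_add[OF g(1)] linear_scale[OF g(1)])
    qed
    then show ?thesis by blast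
  qed
  define L where "L x = g x + a *\<^sub>R x" for x
  have L: "linear L"
    unfolding L_def by (intro linear_compose_add g(1) linear_scaleR)
  have L_mem: "L x \<in> span b" if "x \<in> span b" for x
    using that gA[OF that] spanS b(3)
    by (auto simp: L_def intro!: span_add span_scale)
  have inj_L: "inj_on L (span b)"
  proof (rule inj_onI)
    fix x x' assume x: "x \<in> span b" "x' \<in> span b" and "L x = L x'"
    then have "L (x - x') = 0" by (simp add: linear_diff[OF L])
    moreover have d: "x - x' \<in> span b" using x by (rule span_diff)
    ultimately have "x - x' = 0" using inj[of "x - x'"] gA[OF d] spanS by (auto simp: L_def)
    then show "x = x'" by simp
  qed
  then have indep: "independent (L ` b)"
    using linear_independent_injective_image[OF L b(2)] by blast
  have card: "card (L ` b) = card b"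
    using inj_on_subset[OF inj_L span_superset] by (rule card_image)
  have surj: "w \<in> L ` span b" if w: "w \<in> span b" for w
  proof (rule ccontr)
    assume "w \<notin> L ` span b"
    then have "w \<notin> span (L ` b)" using linear_span_image[OF L] by simp
    then have "w \<notin> L ` b" using span_base[of w "L ` b"] by blast
    have "independent (insert w (L ` b))"
      using \<open>w \<notin> span (L ` b)\<close> indep by (rule independent_insertI)
    moreover have "insert w (L ` b) \<subseteq> span b" using w L_mem span_superset by blast
    ultimately have "card (insert w (L ` b)) \<le> card b"
      using independent_span_bound[OF \<open>finite b\<close>] by blast
    then show False using card \<open>finite b\<close> \<open>w \<notin> L ` b\<close> by simp
  qed
  have "A v \<in> span b" using v b(3) by blast
  then obtain w where w: "w \<in> span b" "L w = A v" using surj by fastforce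
  have wS: "w \<in> S" using w(1) spanS by blast
  define x where "x = inverse a *\<^sub>R (v - w)"
  have "A (v - w) = a *\<^sub>R w"
  proof -
    have "A v = A w + a *\<^sub>R w" unfolding w(2)[symmetric] L_def gA[OF w(1)] ..
    then show ?thesis using bounded_linear_op_on_diff[OF A S v wS] by simp
  qed
  moreover have "v - w \<in> S" using v wS subspace_diff[OF S] by blast
  ultimately have "x \<in> S" "A x + a *\<^sub>R x = v"
    using a AD(3)[of "v - w" "inverse a"] subspace_scale[OF S] by (auto simp: x_def)
  then show ?thesis by blast
qed

lemma shifted_inv_on_solution:
  fixes S :: "'v::real_inner set"
  assumes S: "subspace S" and A: "bounded_linear_op_on S A" and fin: "finite_rank_on S A"
    and a: "a > 0"
    and pos: "\<And>x. x \<in> S \<Longrightarrow> 0 \<le> P x \<bullet> x"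
    and near: "\<And>x. x \<in> S \<Longrightarrow> norm (P x - A x) \<le> (a / 2) * norm x"
    and v: "v \<in> S"
  shows shifted_inv_on_in: "shifted_inv_on S A a v \<in> S"
    and shifted_inv_on_solves: "A (shifted_inv_on S A a v) + a *\<^sub>R shifted_inv_on S A a v = v"
proof -
  have "x = 0" if "x \<in> S" "A x + a *\<^sub>R x = 0" for x
  proof -
    have "(a / 2) * (norm x)\<^sup>2 \<le> 0"
      using shifted_form_coercive[of P x A a] near[OF that(1)] pos[OF that(1)] that(2) by simp
    then show ?thesis using a by (simp add: mult_le_0_iff)
  qed
  then have "\<exists>x\<in>S. A x + a *\<^sub>R x = v"
    using shifted_finite_rank_surj[OF S A fin _ _ v, of a] a by auto
  then have "v \<in> (\<lambda>u. A u + a *\<^sub>R u) ` S" by blast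
  then show "shifted_inv_on S A a v \<in> S"
    "A (shifted_inv_on S A a v) + a *\<^sub>R shifted_inv_on S A a v = v"
    unfolding shifted_inv_on_def
    by (rule inv_into_into, rule f_inv_into_f)
qed

lemma shifted_solution_bound:
  assumes a: "a > 0" and pos: "0 \<le> P x \<bullet> x"
    and near: "norm (P x - A x) \<le> (a / 2) * norm x"
  shows "norm x \<le> (2 / a) * norm (A x + a *\<^sub>R x)"
proof (cases "x = 0")
  case False
  have "(a / 2) * (norm x)\<^sup>2 \<le> (A x + a *\<^sub>R x) \<bullet> x"
    using shifted_form_coercive[of P x A a, OF near] pos by linarith
  also have "\<dots> \<le> norm (A x + a *\<^sub>R x) * norm x" by (rule norm_cauchy_schwarz)
  finally have "(a / 2) * norm x \<le> norm (A x + a *\<^sub>R x)"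
    using False by (simp add: power2_eq_square)
  then show ?thesis using a by (simp add: field_simps)
qed (use a in simp)

text \<open>
  This is the estimate that gains half a power of \<open>a\<close> over the resolvent bound \<open>2 / a\<close>.  With
  \<open>P = L\<^sup>*L\<close> and \<open>z = L x\<close> the hypothesis on the right-hand side says that it equals \<open>L\<^sup>*g\<close> when tested
  with \<open>x\<close>; then the form \<open>\<parallel>z\<parallel>\<^sup>2\<close> of \<open>P\<close> absorbs the factor \<open>\<parallel>z\<parallel>\<close> of \<open>\<langle>g, z\<rangle>\<close>.
\<close>

lemma shifted_solution_energy_bound:
  assumes a: "a > 0" and form: "P x \<bullet> x = (norm z)\<^sup>2"
    and near: "norm (P x - A x) \<le> (a / 2) * norm x"
    and rhs: "(A x + a *\<^sub>R x) \<bullet> x = g \<bullet> z"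
  shows "norm x \<le> norm g / sqrt a"
proof -
  have "(norm z)\<^sup>2 + (a / 2) * (norm x)\<^sup>2 \<le> g \<bullet> z"
    using shifted_form_coercive[of P x A a, OF near] form rhs by simp
  also have "\<dots> \<le> norm g * norm z" by (rule norm_cauchy_schwarz)
  also have "\<dots> \<le> (norm g)\<^sup>2 / 4 + (norm z)\<^sup>2"
    using zero_le_power2[of "norm g / 2 - norm z"] by (simp add: power2_diff power_divide)
  finally have "a * (norm x)\<^sup>2 \<le> (norm g)\<^sup>2 / 2" by simp
  also have "\<dots> \<le> (norm g)\<^sup>2" by simp
  finally have "(norm x)\<^sup>2 \<le> (norm g / sqrt a)\<^sup>2"
    using a by (simp add: power_divide field_simps)
  then show ?thesis by (rule power2_le_imp_le) (use a in simp)
qed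

text \<open>
  Here \<open>L\<close> stands for the approximation of \<open>K\<^sup>*\<close>.  Shifting the error \<open>w - y\<close> by \<open>a z\<close> turns the term
  \<open>- a y\<close> on the right-hand side of its equation into \<open>- a (y - T z) - a (T z - A z) + a\<^sup>2 z\<close>, and after
  division by \<open>a\<close> only \<open>y - T z\<close> fails to vanish with \<open>a\<close>.  The part \<open>K\<^sup>*\<eta>\<close> of the noise needs the energy
  bound and is split off as \<open>x\<^sub>2\<close>; the resolvent bound handles everything else.
\<close>

lemma perturbed_tikhonov_error:
  fixes S :: "'v::real_inner set"
  assumes S: "subspace S" and K: "bounded_linear_op_on S K" and Ks: "bounded_linear_op_on S Ks"
    and adj: "\<And>u v. u \<in> S \<Longrightarrow> v \<in> S \<Longrightarrow> K u \<bullet> v = u \<bullet> Ks v"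
    and A: "bounded_linear_op_on S A" "finite_rank_on S A" and L: "bounded_linear_op_on S L"
    and a: "a > 0"
    and near_T: "\<And>v. v \<in> S \<Longrightarrow> norm (Ks (K v) - A v) \<le> a / 2 * norm v"
    and near_LK: "\<And>v. v \<in> S \<Longrightarrow> norm (A v - L (K v)) \<le> a\<^sup>2 * norm v"
    and near_Ks: "\<And>v. v \<in> S \<Longrightarrow> norm (L v - Ks v) \<le> sqrt a / 2 * norm v"
    and mem: "y \<in> S" "g \<in> S" "z \<in> S" and noise: "norm (g - K y) \<le> \<delta>"
  shows "norm (shifted_inv_on S A a (L g) - y)
    \<le> 2 * \<delta> / sqrt a + a * (2 * norm y + 4 * norm z) + 2 * norm (y - Ks (K z))"
proof -
  note D = bounded_linear_op_onD(1)[OF K] bounded_linear_op_onD(1)[OF Ks]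
    bounded_linear_op_onD(1)[OF A(1)] bounded_linear_op_onD(1)[OF L]
  note sub = subspace_diff[OF S] subspace_add[OF S] subspace_scale[OF S]
  have form: "Ks (K x) \<bullet> x = (norm (K x))\<^sup>2" if "x \<in> S" for x
    using adj[of x "K x"] that D by (simp add: power2_norm_eq_inner inner_commute)
  then have pos: "0 \<le> Ks (K x) \<bullet> x" if "x \<in> S" for x using that by simp
  have inv: "shifted_inv_on S A a v \<in> S"
      "A (shifted_inv_on S A a v) + a *\<^sub>R shifted_inv_on S A a v = v" if "v \<in> S" for v
    using shifted_inv_on_solution[of S A a "\<lambda>x. Ks (K x)", OF S A a pos near_T that] by simp_all
  define \<eta> where "\<eta> = g - K y"
  define w where "w = shifted_inv_on S A a (L g)"
  define x\<^sub>2 where "x\<^sub>2 = shifted_inv_on S A a (Ks \<eta>)"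
  define x\<^sub>1 where "x\<^sub>1 = w - y + a *\<^sub>R z - x\<^sub>2"
  have \<eta>: "\<eta> \<in> S" unfolding \<eta>_def by (intro sub D mem)
  have w: "w \<in> S" "A w + a *\<^sub>R w = L g"
    unfolding w_def by (rule inv[OF D(4)[OF mem(2)]])+
  have x\<^sub>2: "x\<^sub>2 \<in> S" "A x\<^sub>2 + a *\<^sub>R x\<^sub>2 = Ks \<eta>"
    unfolding x\<^sub>2_def by (rule inv[OF D(2)[OF \<eta>]])+
  have x\<^sub>1: "x\<^sub>1 \<in> S" unfolding x\<^sub>1_def by (intro sub w(1) x\<^sub>2(1) mem)
  have "norm x\<^sub>2 \<le> norm \<eta> / sqrt a"
  proof (rule shifted_solution_energy_bound[of a "\<lambda>x. Ks (K x)", OF a form near_T])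
    show "(A x\<^sub>2 + a *\<^sub>R x\<^sub>2) \<bullet> x\<^sub>2 = \<eta> \<bullet> K x\<^sub>2"
      unfolding x\<^sub>2(2) using adj[OF x\<^sub>2(1) \<eta>] by (simp only: inner_commute)
  qed (rule x\<^sub>2(1))+
  also have "\<dots> \<le> \<delta> / sqrt a" using noise a by (simp add: \<eta>_def divide_right_mono)
  finally have x\<^sub>2_le: "norm x\<^sub>2 \<le> \<delta> / sqrt a" .
  have tri: "norm (b\<^sub>1 - b\<^sub>2 - b\<^sub>3 - b\<^sub>4 + b\<^sub>5) \<le> norm b\<^sub>1 + norm b\<^sub>2 + norm b\<^sub>3 + norm b\<^sub>4 + norm b\<^sub>5"
    for b\<^sub>1 b\<^sub>2 b\<^sub>3 b\<^sub>4 b\<^sub>5 :: 'v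
    using norm_triangle_ineq[of "b\<^sub>1 - b\<^sub>2 - b\<^sub>3 - b\<^sub>4" b\<^sub>5] norm_triangle_ineq4[of "b\<^sub>1 - b\<^sub>2 - b\<^sub>3" b\<^sub>4]
      norm_triangle_ineq4[of "b\<^sub>1 - b\<^sub>2" b\<^sub>3] norm_triangle_ineq4[of b\<^sub>1 b\<^sub>2]
    by linarith
  have "A x\<^sub>1 = A w - A y + a *\<^sub>R A z - A x\<^sub>2"
    unfolding x\<^sub>1_def using w(1) x\<^sub>2(1) mem sub
    by (simp add: bounded_linear_op_on_diff[OF A(1) S] bounded_linear_op_onD(2,3)[OF A(1)])
  then have "A x\<^sub>1 + a *\<^sub>R x\<^sub>1
      = (A w + a *\<^sub>R w) - (A x\<^sub>2 + a *\<^sub>R x\<^sub>2) - A y - a *\<^sub>R y + a *\<^sub>R (A z + a *\<^sub>R z)"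
    by (simp add: x\<^sub>1_def algebra_simps)
  also have "\<dots> = (L g - L (K y) - Ks \<eta>) - (A y - L (K y)) - a *\<^sub>R (y - Ks (K z))
      - a *\<^sub>R (Ks (K z) - A z) + (a * a) *\<^sub>R z"
    unfolding w(2) x\<^sub>2(2) by (simp add: algebra_simps)
  also have "L g - L (K y) = L \<eta>"
    unfolding \<eta>_def using bounded_linear_op_on_diff[OF L S] mem D by simp
  finally have "norm (A x\<^sub>1 + a *\<^sub>R x\<^sub>1) \<le> norm (L \<eta> - Ks \<eta>) + norm (A y - L (K y))
      + a * norm (y - Ks (K z)) + a * norm (Ks (K z) - A z) + (a * a) * norm z"
    using tri[of "L \<eta> - Ks \<eta>" "A y - L (K y)" "a *\<^sub>R (y - Ks (K z))"
        "a *\<^sub>R (Ks (K z) - A z)" "(a * a) *\<^sub>R z"] a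
    by simp
  also have "\<dots> \<le> sqrt a / 2 * \<delta> + a\<^sup>2 * norm y
      + a * norm (y - Ks (K z)) + a * (a / 2 * norm z) + (a * a) * norm z"
  proof -
    have "norm (L \<eta> - Ks \<eta>) \<le> sqrt a / 2 * norm \<eta>" by (rule near_Ks[OF \<eta>])
    also have "\<dots> \<le> sqrt a / 2 * \<delta>" using noise a by (intro mult_left_mono) (auto simp: \<eta>_def)
    finally show ?thesis
      using near_LK[OF mem(1)] mult_left_mono[OF near_T[OF mem(3)], of a] a by linarith
  qed
  finally have le: "norm (A x\<^sub>1 + a *\<^sub>R x\<^sub>1) \<le> sqrt a / 2 * \<delta> + a\<^sup>2 * norm y
      + a * norm (y - Ks (K z)) + a * (a / 2 * norm z) + (a * a) * norm z" .
  have "norm x\<^sub>1 \<le> (2 / a) * (sqrt a / 2 * \<delta> + a\<^sup>2 * norm y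
      + a * norm (y - Ks (K z)) + a * (a / 2 * norm z) + (a * a) * norm z)"
    by (rule order_trans[OF shifted_solution_bound[of a "\<lambda>x. Ks (K x)" x\<^sub>1 A,
            OF a pos[OF x\<^sub>1] near_T[OF x\<^sub>1]] mult_left_mono[OF le]])
      (use a in simp)
  also have "\<dots> = \<delta> / sqrt a + 2 * a * norm y + 2 * norm (y - Ks (K z)) + 3 * a * norm z"
  proof -
    have "(2 / a) * (sqrt a / 2 * \<delta>) = \<delta> / sqrt a"
      using a real_sqrt_mult_self[of a] by (simp add: field_simps)
    then show ?thesis using a by (simp add: distrib_left power2_eq_square)
  qed
  finally have x\<^sub>1_le: "norm x\<^sub>1
    \<le> \<delta> / sqrt a + 2 * a * norm y + 2 * norm (y - Ks (K z)) + 3 * a * norm z" .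
  have "w - y = x\<^sub>1 + x\<^sub>2 - a *\<^sub>R z" by (simp add: x\<^sub>1_def)
  then have "norm (w - y) \<le> norm x\<^sub>1 + norm x\<^sub>2 + a * norm z"
    using norm_triangle_ineq4[of "x\<^sub>1 + x\<^sub>2" "a *\<^sub>R z"] norm_triangle_ineq[of x\<^sub>1 x\<^sub>2] a by simp
  moreover have "2 * \<delta> / sqrt a = \<delta> / sqrt a + \<delta> / sqrt a" by simp
  moreover have "a * (2 * norm y + 4 * norm z) = 2 * a * norm y + 3 * a * norm z + a * norm z"
    by (simp add: algebra_simps)
  ultimately show ?thesis unfolding w_def[symmetric] using x\<^sub>1_le x\<^sub>2_le by linarith
qed

text \<open>
  The noise enters through the resolvent bound; the exact data \<open>K y\<close> are in the range of \<open>K\<close> and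
  the energy bound applies to them, with \<open>K\<^sup>*\<close> in the role of the factor.
\<close>

lemma perturbed_residual_bound:
  fixes S :: "'v::real_inner set"
  assumes S: "subspace S" and K: "bounded_linear_op_on S K" and Ks: "bounded_linear_op_on S Ks"
    and adj: "\<And>u v. u \<in> S \<Longrightarrow> v \<in> S \<Longrightarrow> K u \<bullet> v = u \<bullet> Ks v"
    and A: "bounded_linear_op_on S A" "finite_rank_on S A"
    and a: "a > 0"
    and near_Q: "\<And>v. v \<in> S \<Longrightarrow> norm (K (Ks v) - A v) \<le> a / 2 * norm v"
    and mem: "y \<in> S" "g \<in> S" and noise: "norm (g - K y) \<le> \<delta>"
  shows "a * norm (shifted_inv_on S A a g) \<le> 2 * \<delta> + sqrt a * norm y"
proof -
  note D = bounded_linear_op_onD(1)[OF K] bounded_linear_op_onD(1)[OF Ks]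
  have form: "K (Ks x) \<bullet> x = (norm (Ks x))\<^sup>2" if "x \<in> S" for x
    using adj[of "Ks x" x] that D by (simp add: power2_norm_eq_inner)
  then have pos: "0 \<le> K (Ks x) \<bullet> x" if "x \<in> S" for x using that by simp
  have inv: "shifted_inv_on S A a v \<in> S"
      "A (shifted_inv_on S A a v) + a *\<^sub>R shifted_inv_on S A a v = v" if "v \<in> S" for v
    using shifted_inv_on_solution[of S A a "\<lambda>x. K (Ks x)", OF S A a pos near_Q that] by simp_all
  define x where "x = shifted_inv_on S A a g"
  define x\<^sub>2 where "x\<^sub>2 = shifted_inv_on S A a (K y)"
  have x: "x \<in> S" "A x + a *\<^sub>R x = g" unfolding x_def using inv mem by auto
  have x\<^sub>2: "x\<^sub>2 \<in> S" "A x\<^sub>2 + a *\<^sub>R x\<^sub>2 = K y" unfolding x\<^sub>2_def using inv mem D by auto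
  have d: "x - x\<^sub>2 \<in> S" using x x\<^sub>2 subspace_diff[OF S] by blast
  have "A (x - x\<^sub>2) + a *\<^sub>R (x - x\<^sub>2) = (A x + a *\<^sub>R x) - (A x\<^sub>2 + a *\<^sub>R x\<^sub>2)"
    using bounded_linear_op_on_diff[OF A(1) S x(1) x\<^sub>2(1)] by (simp add: algebra_simps)
  then have "norm (x - x\<^sub>2) \<le> (2 / a) * norm (g - K y)"
    using shifted_solution_bound[of a "\<lambda>x. K (Ks x)" "x - x\<^sub>2" A, OF a pos[OF d] near_Q[OF d]] x x\<^sub>2 by simp
  also have "\<dots> \<le> (2 / a) * \<delta>" using noise a by (intro mult_left_mono) auto
  finally have 1: "a * norm (x - x\<^sub>2) \<le> 2 * \<delta>" using a by (simp add: field_simps)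
  have "norm x\<^sub>2 \<le> norm y / sqrt a"
  proof (rule shifted_solution_energy_bound[of a "\<lambda>x. K (Ks x)", OF a form near_Q])
    show "(A x\<^sub>2 + a *\<^sub>R x\<^sub>2) \<bullet> x\<^sub>2 = y \<bullet> Ks x\<^sub>2"
      unfolding x\<^sub>2(2) using adj[OF mem(1) x\<^sub>2(1)] .
  qed (rule x\<^sub>2(1))+
  then have "a * norm x\<^sub>2 \<le> a * (norm y / sqrt a)" using a by (intro mult_left_mono) auto
  also have "\<dots> = sqrt a * norm y"
    using a real_sqrt_mult_self[of a] by (simp add: field_simps)
  finally have 2: "a * norm x\<^sub>2 \<le> sqrt a * norm y" .
  have "norm x \<le> norm (x - x\<^sub>2) + norm x\<^sub>2" using norm_triangle_ineq[of "x - x\<^sub>2" x\<^sub>2] by simp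
  then have "a * norm x \<le> a * norm (x - x\<^sub>2) + a * norm x\<^sub>2"
    using mult_left_mono[of "norm x" "norm (x - x\<^sub>2) + norm x\<^sub>2" a] a by (simp add: distrib_left)
  with 1 2 show ?thesis unfolding x_def by linarith
qed

section \<open>Geometric averages and the stopping index\<close>

text \<open>
  The error of the average obeys the same recursion as the average itself.  The coefficient of \<open>M\<close>
  that reproduces itself is \<open>1 + p\<close>, since \<open>p\<^sup>2 (1 + p) + (1 - p\<^sup>2) p = p (1 + p)\<close>; that of \<open>N\<close> is \<open>1\<close>,
  since \<open>p\<^sup>3 + 1 - p\<^sup>2 \<le> 1\<close>.
\<close>

lemma geometric_average_bound:
  fixes s w :: "nat \<Rightarrow> 'v::real_normed_vector"
  assumes p: "0 < p" "p < 1" and nonneg: "0 \<le> M" "0 \<le> N" "0 \<le> E"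
    and s0: "s 0 = 0"
    and rec: "\<And>n. n \<ge> 1 \<Longrightarrow> s n = p\<^sup>2 *\<^sub>R s (n - 1) + (1 - p\<^sup>2) *\<^sub>R w n"
    and err: "\<And>n. n \<ge> 1 \<Longrightarrow> norm (w n - y) \<le> E + M * p ^ n + N / p ^ n"
  shows "norm (s n - y) \<le> E + (norm y + 2 * M) * p ^ n + N / p ^ n"
proof -
  have p2: "p\<^sup>2 \<le> 1" using p by (simp add: power_le_one)
  have "norm (s n - y) \<le> E + (norm y + (1 + p) * M) * p ^ n + N / p ^ n"
  proof (induction n)
    case 0
    then show ?case using s0 p nonneg by simp
  next
    case (Suc n)
    let ?X = "p ^ n"
    have X: "0 < ?X" using p by simp
    have "s (Suc n) - y = p\<^sup>2 *\<^sub>R (s n - y) + (1 - p\<^sup>2) *\<^sub>R (w (Suc n) - y)"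
      using rec[of "Suc n"] by (simp add: algebra_simps)
    then have "norm (s (Suc n) - y) \<le> p\<^sup>2 * norm (s n - y) + (1 - p\<^sup>2) * norm (w (Suc n) - y)"
      using norm_triangle_ineq[of "p\<^sup>2 *\<^sub>R (s n - y)" "(1 - p\<^sup>2) *\<^sub>R (w (Suc n) - y)"] p2 by simp
    also have "\<dots> \<le> p\<^sup>2 * (E + (norm y + (1 + p) * M) * ?X + N / ?X)
        + (1 - p\<^sup>2) * (E + M * (p * ?X) + N / (p * ?X))"
      using err[of "Suc n"] p2 by (intro add_mono mult_left_mono Suc) auto
    also have "\<dots> = E + p * (norm y * (p * ?X)) + (1 + p) * M * (p * ?X)
        + (1 - p\<^sup>2 * (1 - p)) * (N / (p * ?X))"
      using p X by (simp add: field_simps power2_eq_square)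
    also have "\<dots> \<le> E + 1 * (norm y * (p * ?X)) + (1 + p) * M * (p * ?X) + 1 * (N / (p * ?X))"
      using p X nonneg by (intro add_mono mult_right_mono order_refl) auto
    finally show ?case by (simp add: algebra_simps)
  qed
  also have "\<dots> \<le> E + (norm y + 2 * M) * p ^ n + N / p ^ n"
    using p nonneg by (intro add_mono mult_right_mono order_refl) auto
  finally show ?thesis .
qed

text \<open>
  The index used is the predecessor of the stopping index, or \<open>1\<close> if that is \<open>0\<close>.  There the lower
  bound \<open>C \<delta>\<^sup>\<theta>\<close> for \<open>G\<close> meets the upper bound, and \<open>2 \<delta> \<le> 2 \<delta>\<^sup>\<theta>\<close> for small \<open>\<delta>\<close>.
\<close>

lemma stopping_noise_tendsto_0:
  fixes G :: "real \<Rightarrow> nat \<Rightarrow> real"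
  assumes pos: "\<Delta> \<subseteq> {0<..}" and p: "0 < p" "p < 1" and C: "2 < C"
    and \<theta>: "0 < \<theta>" "\<theta> < 1" and B: "0 \<le> B"
    and upper: "\<And>\<delta> n. \<delta> \<in> \<Delta> \<Longrightarrow> G \<delta> n \<le> 2 * \<delta> + B * p ^ n"
    and G1: "\<And>\<delta>. \<delta> \<in> \<Delta> \<Longrightarrow> C * \<delta> powr \<theta> \<le> G \<delta> 1"
    and before: "\<And>\<delta> n. \<delta> \<in> \<Delta> \<Longrightarrow> 1 \<le> n \<Longrightarrow> n < \<nu> \<delta> \<Longrightarrow> C * \<delta> powr \<theta> < G \<delta> n"
  shows "((\<lambda>\<delta>. \<delta> / p ^ \<nu> \<delta>) \<longlongrightarrow> 0) (at 0 within \<Delta>)"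
proof -
  have ev: "\<forall>\<^sub>F \<delta> in at 0 within \<Delta>. 0 \<le> \<delta>"
    unfolding eventually_at_filter using pos by (intro always_eventually) auto
  have "((\<lambda>\<delta>. B / ((C - 2) * p) * \<delta> powr (1 - \<theta>)) \<longlongrightarrow> B / ((C - 2) * p) * 0 powr (1 - \<theta>))
      (at 0 within \<Delta>)"
    by (rule tendsto_mult[OF tendsto_const tendsto_powr'[OF tendsto_ident_at tendsto_const]])
      (use \<theta> ev in simp)
  then have lim: "((\<lambda>\<delta>. B / ((C - 2) * p) * \<delta> powr (1 - \<theta>)) \<longlongrightarrow> 0) (at 0 within \<Delta>)" by simp
  have small: "\<forall>\<^sub>F \<delta> in at 0 within \<Delta>. \<delta> \<in> \<Delta> \<and> \<delta> < 1"
    unfolding eventually_at by (intro exI[of _ 1]) (auto simp: dist_real_def)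
  then have "\<forall>\<^sub>F \<delta> in at 0 within \<Delta>. \<delta> / p ^ \<nu> \<delta> \<le> B / ((C - 2) * p) * \<delta> powr (1 - \<theta>)"
  proof eventually_elim
    case (elim \<delta>)
    then have \<delta>: "\<delta> \<in> \<Delta>" "0 < \<delta>" "\<delta> < 1" using pos by auto
    define k where "k = max 1 (\<nu> \<delta> - 1)"
    have "C * \<delta> powr \<theta> \<le> G \<delta> k"
    proof (cases "k = 1")
      case True
      then show ?thesis using G1 \<delta> by simp
    next
      case False
      then have "1 \<le> k" "k < \<nu> \<delta>" by (auto simp: k_def max_def split: if_splits)
      then show ?thesis using before[OF \<delta>(1)] by (simp add: less_imp_le)
    qed
    also have "\<dots> \<le> 2 * \<delta> + B * p ^ k" using upper \<delta> by blast
    also have "\<dots> \<le> 2 * \<delta> powr \<theta> + B * (p ^ \<nu> \<delta> / p)"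
    proof -
      have "\<delta> powr 1 \<le> \<delta> powr \<theta>" using \<delta> \<theta> by (intro powr_mono') auto
      moreover have "p ^ Suc k \<le> p ^ \<nu> \<delta>"
        using p by (intro power_decreasing) (auto simp: k_def)
      then have "p ^ k \<le> p ^ \<nu> \<delta> / p" using p by (simp add: field_simps)
      ultimately show ?thesis using B \<delta> by (intro add_mono mult_left_mono) auto
    qed
    finally have "(C - 2) * \<delta> powr \<theta> \<le> B * p ^ \<nu> \<delta> / p" by (simp add: algebra_simps)
    then have "\<delta> powr \<theta> \<le> B / ((C - 2) * p) * p ^ \<nu> \<delta>" using C p by (simp add: field_simps)
    then have "\<delta> powr \<theta> * \<delta> powr (1 - \<theta>) \<le> B / ((C - 2) * p) * p ^ \<nu> \<delta> * \<delta> powr (1 - \<theta>)"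
      by (rule mult_right_mono) simp
    moreover have "\<delta> powr \<theta> * \<delta> powr (1 - \<theta>) = \<delta>" using \<delta> by (simp flip: powr_add)
    ultimately show ?case using p by (simp add: divide_le_eq mult.commute mult.left_commute)
  qed
  moreover have "\<forall>\<^sub>F \<delta> in at 0 within \<Delta>. 0 \<le> \<delta> / p ^ \<nu> \<delta>"
    using small by eventually_elim (use pos p in \<open>auto intro!: divide_nonneg_pos\<close>)
  ultimately show ?thesis by (intro tendsto_sandwich[OF _ _ tendsto_const lim])
qed

text \<open>
  As \<open>G\<close> falls at most geometrically, \<open>G\<close> at the stopping index is at least \<open>c p\<^bsup>2 \<nu>\<^esup>\<close>, whereas the
  stopping rule bounds it by \<open>C \<delta>\<^sup>\<theta>\<close>.
\<close>

lemma stopping_index_power_tendsto_0: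
  fixes G :: "real \<Rightarrow> nat \<Rightarrow> real"
  assumes pos: "\<Delta> \<subseteq> {0<..}" and p: "0 < p" "p < 1" and C: "0 < C" and \<theta>: "0 < \<theta>"
    and c: "0 < c" "\<forall>\<^sub>F \<delta> in at 0 within \<Delta>. c \<le> G \<delta> 1"
    and decay: "\<And>\<delta> n. \<delta> \<in> \<Delta> \<Longrightarrow> p\<^sup>2 * G \<delta> n \<le> G \<delta> (Suc n)"
    and ge1: "\<And>\<delta>. \<delta> \<in> \<Delta> \<Longrightarrow> 1 \<le> \<nu> \<delta>"
    and stop: "\<And>\<delta>. \<delta> \<in> \<Delta> \<Longrightarrow> G \<delta> (\<nu> \<delta>) \<le> C * \<delta> powr \<theta>"
  shows "((\<lambda>\<delta>. p ^ \<nu> \<delta>) \<longlongrightarrow> 0) (at 0 within \<Delta>)"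
proof -
  have ev: "\<forall>\<^sub>F \<delta> in at 0 within \<Delta>. 0 \<le> \<delta>"
    unfolding eventually_at_filter using pos by (intro always_eventually) auto
  have "((\<lambda>\<delta>. sqrt (C / c * \<delta> powr \<theta>)) \<longlongrightarrow> sqrt (C / c * 0 powr \<theta>)) (at 0 within \<Delta>)"
    by (rule tendsto_real_sqrt[OF tendsto_mult[OF tendsto_const
            tendsto_powr'[OF tendsto_ident_at tendsto_const]]])
      (use \<theta> ev in simp)
  then have lim: "((\<lambda>\<delta>. sqrt (C / c * \<delta> powr \<theta>)) \<longlongrightarrow> 0) (at 0 within \<Delta>)" by simp
  have geom: "(p\<^sup>2) ^ n * G \<delta> 1 \<le> G \<delta> (Suc n)" if "\<delta> \<in> \<Delta>" for \<delta> n
  proof (induction n)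
    case (Suc n)
    have "(p\<^sup>2) ^ Suc n * G \<delta> 1 \<le> p\<^sup>2 * G \<delta> (Suc n)"
      using mult_left_mono[OF Suc, of "p\<^sup>2"] by (simp add: algebra_simps)
    also have "\<dots> \<le> G \<delta> (Suc (Suc n))" using decay that by blast
    finally show ?case .
  qed simp
  have "\<forall>\<^sub>F \<delta> in at 0 within \<Delta>. \<delta> \<in> \<Delta>"
    by (simp add: eventually_at_filter)
  with c(2) have "\<forall>\<^sub>F \<delta> in at 0 within \<Delta>. p ^ \<nu> \<delta> \<le> sqrt (C / c * \<delta> powr \<theta>)"
  proof eventually_elim
    case (elim \<delta>)
    obtain n where n: "\<nu> \<delta> = Suc n" using ge1[OF elim(2)] by (cases "\<nu> \<delta>") auto
    have "(p ^ \<nu> \<delta>)\<^sup>2 * c \<le> (p\<^sup>2) ^ n * c"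
    proof -
      have "(p ^ \<nu> \<delta>)\<^sup>2 = (p\<^sup>2) ^ \<nu> \<delta>" by (simp flip: power_mult add: mult.commute)
      also have "\<dots> \<le> (p\<^sup>2) ^ n" using p n by (intro power_decreasing) (auto simp: power_le_one)
      finally show ?thesis using c by (intro mult_right_mono) auto
    qed
    also have "\<dots> \<le> (p\<^sup>2) ^ n * G \<delta> 1" using elim(1) by (intro mult_left_mono) auto
    also have "\<dots> \<le> G \<delta> (\<nu> \<delta>)" using geom[OF elim(2)] n by simp
    also have "\<dots> \<le> C * \<delta> powr \<theta>" using stop elim(2) by blast
    finally have "(p ^ \<nu> \<delta>)\<^sup>2 \<le> C / c * \<delta> powr \<theta>" using c by (simp add: field_simps)
    then show ?case by (rule real_le_rsqrt)
  qed
  then show ?thesis using p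
    by (intro tendsto_sandwich[OF _ _ tendsto_const lim]) auto
qed

section \<open>The space of square integrable functions on an interval\<close>

lemma l2_of_add:
  assumes "square_integrable f" "square_integrable g"
  shows "l2_of f + l2_of g = l2_of (\<lambda>x. f x + g x)"
  unfolding l2_of_def using assms by (intro plus_l2.abs_eq) (simp_all add: l2_rel_def)

lemma l2_of_scaleR:
  assumes "square_integrable f"
  shows "r *\<^sub>R l2_of f = l2_of (\<lambda>x. r *\<^sub>R f x)"
  unfolding l2_of_def using assms by (intro scaleR_l2.abs_eq) (simp_all add: l2_rel_def)

lemma l2_fun_add: "AE x in lborel. l2_fun (u + v) x = l2_fun u x + l2_fun v x"
  using l2_fun_l2_of[OF square_integrable_add[OF square_integrable_l2_fun square_integrable_l2_fun], of u v]
  by (simp add: l2_of_l2_fun flip: l2_of_add[OF square_integrable_l2_fun square_integrable_l2_fun])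

lemma l2_fun_scaleR: "AE x in lborel. l2_fun (r *\<^sub>R u) x = r *\<^sub>R l2_fun u x"
  using l2_fun_l2_of[OF square_integrable_scaleR[OF square_integrable_l2_fun], of r u]
  by (simp add: l2_of_l2_fun flip: l2_of_scaleR[OF square_integrable_l2_fun])

lemma l2_fun_diff: "AE x in lborel. l2_fun (u - v) x = l2_fun u x - l2_fun v x"
  using l2_fun_add[of u "(-1) *\<^sub>R v"] l2_fun_scaleR[of "-1" v] by eventually_elim simp

lemma borel_measurable_l2_fun [measurable]: "l2_fun u \<in> borel_measurable borel"
  using square_integrable_l2_fun[of u] by (simp add: square_integrable_def)

lemma norm_l2_sq: "(norm u)\<^sup>2 = (LINT x|lborel. (norm (l2_fun u x))\<^sup>2)"
  by (simp add: power2_norm_eq_inner inner_l2_eq)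

lemma nn_integral_l2_diff:
  "(\<integral>\<^sup>+x. ennreal ((norm (l2_fun u x - l2_fun v x))\<^sup>2) \<partial>lborel) = ennreal ((norm (u - v))\<^sup>2)"
proof -
  have "(\<integral>\<^sup>+x. ennreal ((norm (l2_fun u x - l2_fun v x))\<^sup>2) \<partial>lborel)
      = (\<integral>\<^sup>+x. ennreal ((norm (l2_fun (u - v) x))\<^sup>2) \<partial>lborel)"
    by (intro nn_integral_cong_AE) (use l2_fun_diff[of u v] in eventually_elim, simp)
  also have "\<dots> = ennreal (LINT x|lborel. (norm (l2_fun (u - v) x))\<^sup>2)"
    using square_integrable_l2_fun[of "u - v"]
    by (intro nn_integral_eq_integral) (auto simp: square_integrable_def)
  finally show ?thesis by (simp add: norm_l2_sq)
qed

text \<open>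
  The Riesz--Fischer argument: a subsequence \<open>g\<^sub>n\<close> with increments \<open>h\<^sub>n\<close> of norm at most \<open>2\<^sup>-\<^sup>n\<close>
  converges almost everywhere, and Fatou's lemma transfers the norm estimates to its limit.  As
  the measure is infinite, summability of the \<open>h\<^sub>n\<close> is not read off from their integrals but from
  those of the squares: the sum of \<open>2\<^sup>n h\<^sub>n\<^sup>2\<close> is integrable, and \<open>h\<^sub>n \<le> 2\<^sup>-\<^sup>n + 2\<^sup>n h\<^sub>n\<^sup>2\<close>.
\<close>

lemma l2_Cauchy_convergent_AE:
  fixes s :: "nat \<Rightarrow> 'a::euclidean_space l2"
  assumes "Cauchy s"
  obtains w r where "s \<longlonglongrightarrow> w" "strict_mono (r :: nat \<Rightarrow> nat)"
    "AE x in lborel. (\<lambda>n. l2_fun (s (r n)) x) \<longlonglongrightarrow> l2_fun w x"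
proof -
  have "\<exists>N. \<forall>i\<ge>N. \<forall>j\<ge>N. norm (s i - s j) < (1/2) ^ n" for n
    using metric_CauchyD[OF assms, of "(1/2) ^ n"] by (auto simp: dist_norm)
  then obtain N where N: "\<And>n i j. i \<ge> N n \<Longrightarrow> j \<ge> N n \<Longrightarrow> norm (s i - s j) < (1/2) ^ n"
    by metis
  define r where "r n = n + (\<Sum>i\<le>n. N i)" for n
  have r: "strict_mono r" by (auto simp: r_def strict_mono_Suc_iff)
  have "N n \<le> r n" for n
    using member_le_sum[of n "{..n}" N] by (simp add: r_def trans_le_add2)
  then have rN: "N n \<le> r k" if "n \<le> k" for n k
    using that strict_mono_leD[OF r, of n k] order_trans by blast
  define g where "g n = l2_fun (s (r n))" for n
  have [measurable]: "g n \<in> borel_measurable borel" for n unfolding g_def by simp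
  have g_diff: "(\<integral>\<^sup>+x. ennreal ((norm (g n x - g k x))\<^sup>2) \<partial>lborel) \<le> ennreal ((1/4) ^ n)"
    if "n \<le> k" for n k
  proof -
    have "norm (s (r n) - s (r k)) \<le> (1/2) ^ n" using N[OF rN rN] that less_imp_le by blast
    then have "(norm (s (r n) - s (r k)))\<^sup>2 \<le> ((1/2) ^ n)\<^sup>2" by (intro power_mono) auto
    also have "\<dots> = (1/4) ^ n" by (simp add: power2_eq_square flip: power_mult_distrib)
    finally show ?thesis unfolding g_def nn_integral_l2_diff by (rule ennreal_leI)
  qed
  have "(\<integral>\<^sup>+x. (\<Sum>n. ennreal (2 ^ n * (norm (g n x - g (Suc n) x))\<^sup>2)) \<partial>lborel)
      = (\<Sum>n. \<integral>\<^sup>+x. ennreal (2 ^ n * (norm (g n x - g (Suc n) x))\<^sup>2) \<partial>lborel)"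
    by (rule nn_integral_suminf) measurable
  also have "\<dots> \<le> (\<Sum>n. ennreal ((1/2) ^ n))"
  proof (rule suminf_le)
    fix n
    have "(\<integral>\<^sup>+x. ennreal (2 ^ n * (norm (g n x - g (Suc n) x))\<^sup>2) \<partial>lborel)
        = ennreal (2 ^ n) * (\<integral>\<^sup>+x. ennreal ((norm (g n x - g (Suc n) x))\<^sup>2) \<partial>lborel)"
      by (simp add: ennreal_mult nn_integral_cmult)
    also have "\<dots> \<le> ennreal (2 ^ n) * ennreal ((1/4) ^ n)"
      by (intro mult_left_mono g_diff) auto
    also have "\<dots> = ennreal ((1/2) ^ n)"
      by (simp flip: ennreal_mult power_mult_distrib)
    finally show "(\<integral>\<^sup>+x. ennreal (2 ^ n * (norm (g n x - g (Suc n) x))\<^sup>2) \<partial>lborel)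
      \<le> ennreal ((1/2) ^ n)" .
  qed auto
  also have "\<dots> < \<infinity>"
    by (subst suminf_ennreal2) (auto intro: summable_geometric)
  finally have "AE x in lborel. (\<Sum>n. ennreal (2 ^ n * (norm (g n x - g (Suc n) x))\<^sup>2)) \<noteq> \<infinity>"
    by (intro nn_integral_PInf_AE) auto
  then have conv: "AE x in lborel. (\<lambda>n. g n x) \<longlonglongrightarrow> lim (\<lambda>n. g n x)"
  proof eventually_elim
    fix x
    let ?h = "\<lambda>n. norm (g n x - g (Suc n) x)"
    assume "(\<Sum>n. ennreal (2 ^ n * (?h n)\<^sup>2)) \<noteq> \<infinity>"
    then have "summable (\<lambda>n. 2 ^ n * (?h n)\<^sup>2)"
      by (intro summable_suminf_not_top) auto
    then have sm: "summable (\<lambda>n. (1/2) ^ n + 2 ^ n * (?h n)\<^sup>2)"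
      by (intro summable_add summable_geometric) auto
    have le: "?h n \<le> (1/2) ^ n + 2 ^ n * (?h n)\<^sup>2" for n
    proof -
      have "0 \<le> (2 ^ n * ?h n - 1)\<^sup>2" by simp
      then have "2 ^ n * (2 * ?h n) \<le> 2 ^ n * (2 ^ n * (?h n)\<^sup>2 + (1/2) ^ n)"
        by (simp add: power2_diff power_mult_distrib algebra_simps power2_eq_square
            flip: power_mult_distrib)
      then have "2 * ?h n \<le> 2 ^ n * (?h n)\<^sup>2 + (1/2) ^ n" by simp
      then show ?thesis using norm_ge_zero[of "g n x - g (Suc n) x"] by linarith
    qed
    have "summable (\<lambda>n. ?h n)"
      by (rule summable_comparison_test'[OF sm, of 0]) (use le in simp)
    then have "summable (\<lambda>n. norm (g (Suc n) x - g n x))" by (simp only: norm_minus_commute)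
    then have "summable (\<lambda>n. g (Suc n) x - g n x)" by (rule summable_norm_cancel)
    then have "(\<lambda>n. \<Sum>i<n. g (Suc i) x - g i x) \<longlonglongrightarrow> (\<Sum>i. g (Suc i) x - g i x)"
      by (rule summable_LIMSEQ)
    then have "(\<lambda>n. g n x - g 0 x) \<longlonglongrightarrow> (\<Sum>i. g (Suc i) x - g i x)"
      by (simp only: sum_lessThan_telescope[of "\<lambda>i. g i x"])
    then have "(\<lambda>n. (g n x - g 0 x) + g 0 x) \<longlonglongrightarrow> (\<Sum>i. g (Suc i) x - g i x) + g 0 x"
      by (rule tendsto_add[OF _ tendsto_const])
    then have "convergent (\<lambda>n. g n x)" by (intro convergentI) simp
    then show "(\<lambda>n. g n x) \<longlonglongrightarrow> lim (\<lambda>n. g n x)" by (simp only: convergent_LIMSEQ_iff)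
  qed
  define gl where "gl x = lim (\<lambda>n. g n x)" for x
  have [measurable]: "gl \<in> borel_measurable borel" unfolding gl_def by measurable
  have fatou: "(\<integral>\<^sup>+x. ennreal ((norm (g n x - gl x))\<^sup>2) \<partial>lborel) \<le> ennreal ((1/4) ^ n)" for n
  proof -
    have "(\<integral>\<^sup>+x. ennreal ((norm (g n x - gl x))\<^sup>2) \<partial>lborel)
        = (\<integral>\<^sup>+x. liminf (\<lambda>k. ennreal ((norm (g n x - g k x))\<^sup>2)) \<partial>lborel)"
    proof (rule nn_integral_cong_AE, use conv in eventually_elim)
      fix x assume "(\<lambda>n. g n x) \<longlonglongrightarrow> lim (\<lambda>n. g n x)"
      then have "(\<lambda>k. ennreal ((norm (g n x - g k x))\<^sup>2)) \<longlonglongrightarrow> ennreal ((norm (g n x - gl x))\<^sup>2)"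
        unfolding gl_def by (intro tendsto_intros)
      then show "ennreal ((norm (g n x - gl x))\<^sup>2)
          = liminf (\<lambda>k. ennreal ((norm (g n x - g k x))\<^sup>2))"
        by (intro lim_imp_Liminf[symmetric]) auto
    qed
    also have "\<dots> \<le> liminf (\<lambda>k. \<integral>\<^sup>+x. ennreal ((norm (g n x - g k x))\<^sup>2) \<partial>lborel)"
      by (rule nn_integral_liminf) measurable
    also have "\<dots> \<le> liminf (\<lambda>k. ennreal ((1/4) ^ n))"
      by (intro Liminf_mono eventually_sequentiallyI[of n] g_diff)
    finally show ?thesis by (simp add: Liminf_const)
  qed
  have "integrable lborel (\<lambda>x. (norm (g n x - gl x))\<^sup>2)" for n
    by (rule integrableI_bounded) (use fatou[of n] in \<open>auto simp: le_less_trans\<close>)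
  then have "square_integrable (\<lambda>x. g n x - gl x)" for n
    by (simp add: square_integrable_def)
  from square_integrable_add[OF square_integrable_scaleR[OF this[of 0], of "-1"]
      square_integrable_l2_fun[of "s (r 0)"]]
  have gl: "square_integrable gl" by (simp add: g_def)
  define w where "w = l2_of gl"
  have w: "AE x in lborel. l2_fun w x = gl x"
    unfolding w_def using gl by (rule l2_fun_l2_of)
  have "norm (s (r n) - w) \<le> (1/2) ^ n" for n
  proof -
    have "ennreal ((norm (s (r n) - w))\<^sup>2)
        = (\<integral>\<^sup>+x. ennreal ((norm (g n x - gl x))\<^sup>2) \<partial>lborel)"
      unfolding nn_integral_l2_diff[symmetric] g_def
      by (intro nn_integral_cong_AE) (use w in eventually_elim, simp)
    also have "\<dots> \<le> ennreal ((1/4) ^ n)" by (rule fatou)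
    finally have "(norm (s (r n) - w))\<^sup>2 \<le> (1/4) ^ n"
      by (rule iffD1[OF ennreal_le_iff, rotated]) simp
    also have "\<dots> = ((1/2) ^ n)\<^sup>2" by (simp add: power2_eq_square flip: power_mult_distrib)
    finally show ?thesis by (rule power2_le_imp_le) simp
  qed
  then have le: "\<forall>\<^sub>F n in sequentially. norm (s (r n) - w) \<le> (1/2) ^ n" by simp
  have "(\<lambda>n. (1/2) ^ n :: real) \<longlonglongrightarrow> 0" by (simp add: LIMSEQ_power_zero)
  with le have "(\<lambda>n. s (r n) - w) \<longlonglongrightarrow> 0" by (rule Lim_null_comparison)
  then have "(s \<circ> r) \<longlonglongrightarrow> w" by (simp add: LIM_zero_iff comp_def)
  then have "s \<longlonglongrightarrow> w" using Cauchy_converges_subseq[OF assms r] by blast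
  moreover have "AE x in lborel. (\<lambda>n. l2_fun (s (r n)) x) \<longlonglongrightarrow> l2_fun w x"
    using conv w by eventually_elim (simp add: g_def gl_def)
  ultimately show ?thesis using that r by blast
qed

lemma complete_L2: "complete (L2 c d)"
  unfolding complete_def
proof (intro allI impI, elim conjE)
  fix s :: "nat \<Rightarrow> 'a l2" assume s: "\<forall>n. s n \<in> L2 c d" "Cauchy s"
  from s(2) obtain w r where w: "s \<longlonglongrightarrow> w"
    "AE x in lborel. (\<lambda>n. l2_fun (s (r n)) x) \<longlonglongrightarrow> l2_fun w x"
    by (rule l2_Cauchy_convergent_AE)
  have "AE x in lborel. \<forall>n. x \<notin> {c..d} \<longrightarrow> l2_fun (s n) x = 0"
    using s(1) unfolding AE_all_countable L2_def by auto
  with w(2) have "AE x in lborel. x \<notin> {c..d} \<longrightarrow> l2_fun w x = 0"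
  proof eventually_elim
    case (elim x)
    show ?case
    proof
      assume "x \<notin> {c..d}"
      then have "(\<lambda>n. 0) \<longlonglongrightarrow> l2_fun w x" using elim by simp
      then show "l2_fun w x = 0" by (simp add: LIMSEQ_const_iff)
    qed
  qed
  with w(1) show "\<exists>l\<in>L2 c d. s \<longlonglongrightarrow> l" by (auto simp: L2_def)
qed

lemma subspace_L2: "subspace (L2 c d)"
proof (rule subspaceI)
  show "0 \<in> L2 c d"
    using l2_fun_scaleR[of 0 0] by (auto simp: L2_def elim: eventually_mono)
  show "u + v \<in> L2 c d" if "u \<in> L2 c d" "v \<in> L2 c d" for u v :: "'a l2"
  proof -
    have "AE x in lborel. x \<notin> {c..d} \<longrightarrow> l2_fun u x = 0"
      "AE x in lborel. x \<notin> {c..d} \<longrightarrow> l2_fun v x = 0"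
      using that by (auto simp: L2_def)
    with l2_fun_add[of u v] have "AE x in lborel. x \<notin> {c..d} \<longrightarrow> l2_fun (u + v) x = 0"
      by eventually_elim simp
    then show ?thesis by (simp add: L2_def)
  qed
  show "r *\<^sub>R u \<in> L2 c d" if "u \<in> L2 c d" for r and u :: "'a l2"
  proof -
    have "AE x in lborel. x \<notin> {c..d} \<longrightarrow> l2_fun u x = 0"
      using that by (auto simp: L2_def)
    with l2_fun_scaleR[of r u] have "AE x in lborel. x \<notin> {c..d} \<longrightarrow> l2_fun (r *\<^sub>R u) x = 0"
      by eventually_elim simp
    then show ?thesis by (simp add: L2_def)
  qed
qed

text \<open>
  The kernel is cut off outside the square, where nothing is known about its measurability.  On
  the unit ball the bound \<open>t \<le> 1 + t\<^sup>2\<close> gives an integrable majorant and a uniform estimate, which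
  homogeneity turns into an operator bound.
\<close>

lemma bounded_linear_op_on_integral_op:
  fixes k :: "real \<Rightarrow> real \<Rightarrow> 'a::{real_normed_field,euclidean_space}"
  assumes k: "continuous_on ({c..d} \<times> {c..d}) (\<lambda>(x, z). k x z)" and "c \<le> d"
  shows "bounded_linear_op_on (L2 c d) (integral_op c d k)"
proof -
  let ?I = "indicat_real {c..d}"
  define \<kappa> where "\<kappa> x z = (?I x * ?I z) *\<^sub>R k x z" for x z
  define F where "F u x = (LINT z|lborel. \<kappa> x z * l2_fun u z)" for u :: "'a l2" and x
  have op: "integral_op c d k u = l2_of (F u)" for u
  proof -
    have "?I x *\<^sub>R (LINT z:{c..d}|lborel. k x z * l2_fun u z) = F u x" for x
      unfolding F_def \<kappa>_def set_lebesgue_integral_def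
      by (cases "x \<in> {c..d}") (simp_all add: indicator_def)
    then show ?thesis by (simp add: integral_op_def)
  qed
  have "(\<lambda>p. indicator ({c..d} \<times> {c..d}) p *\<^sub>R (\<lambda>(x, z). k x z) p) \<in> borel_measurable borel"
    by (intro borel_measurable_continuous_on_indicator k) (simp add: borel_closed closed_Times)
  also have "(\<lambda>p. indicator ({c..d} \<times> {c..d}) p *\<^sub>R (\<lambda>(x, z). k x z) p) = (\<lambda>(x, z). \<kappa> x z)"
    by (auto simp: \<kappa>_def fun_eq_iff indicator_def)
  finally have \<kappa>_meas [measurable]: "(\<lambda>(x, z). \<kappa> x z) \<in> borel_measurable (borel \<Otimes>\<^sub>M borel)"
    by (simp add: borel_prod)
  have [measurable]: "\<kappa> x \<in> borel_measurable borel" for x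
    using measurable_compose[OF measurable_Pair1'[of x borel borel] \<kappa>_meas] by simp
  have F_meas [measurable]: "F u \<in> borel_measurable borel" for u
    unfolding F_def
    using lborel.borel_measurable_lebesgue_integral[of "\<lambda>x z. \<kappa> x z * l2_fun u z" borel]
    by measurable
  obtain M where M: "M > 0" "\<And>x z. x \<in> {c..d} \<Longrightarrow> z \<in> {c..d} \<Longrightarrow> norm (k x z) \<le> M"
  proof -
    have "bounded ((\<lambda>(x, z). k x z) ` ({c..d} \<times> {c..d}))"
      by (intro compact_imp_bounded compact_continuous_image k compact_Times compact_Icc)
    then obtain M where "M > 0" "\<forall>p\<in>{c..d} \<times> {c..d}. norm ((\<lambda>(x, z). k x z) p) \<le> M"
      unfolding bounded_pos by auto
    then show ?thesis using that by auto
  qed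
  have dom: "norm (\<kappa> x z * l2_fun u z) \<le> M * (?I z + (norm (l2_fun u z))\<^sup>2)" for u x z
  proof (cases "x \<in> {c..d} \<and> z \<in> {c..d}")
    case True
    have "0 \<le> (norm (l2_fun u z) - 1)\<^sup>2" by simp
    then have "norm (l2_fun u z) \<le> 1 + (norm (l2_fun u z))\<^sup>2"
      by (simp add: power2_diff) (use norm_ge_zero[of "l2_fun u z"] in linarith)
    then show ?thesis using True M
      by (auto simp: \<kappa>_def norm_mult intro!: mult_mono)
  next
    case False
    then have "\<kappa> x z = 0" by (auto simp: \<kappa>_def indicator_def)
    then show ?thesis using M(1) by simp
  qed
  have sq: "integrable lborel (\<lambda>z. (norm (l2_fun u z))\<^sup>2)" for u :: "'a l2"
    using square_integrable_l2_fun[of u] by (simp add: square_integrable_def)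
  have I_int: "integrable lborel ?I" using \<open>c \<le> d\<close> by simp
  have maj: "integrable lborel (\<lambda>z. M * (?I z + (norm (l2_fun u z))\<^sup>2))" for u :: "'a l2"
    by (intro integrable_mult_right Bochner_Integration.integrable_add sq I_int)
  have int: "integrable lborel (\<lambda>z. \<kappa> x z * l2_fun u z)" for x u
    by (rule Bochner_Integration.integrable_bound[OF maj[of u]])
      (auto intro!: AE_I2 order_trans[OF dom abs_ge_self])
  have F_bound: "norm (F u x) \<le> (M * ((d - c) + (norm u)\<^sup>2)) * ?I x" for u x
  proof (cases "x \<in> {c..d}")
    case True
    have "norm (F u x) \<le> (LINT z|lborel. norm (\<kappa> x z * l2_fun u z))"
      unfolding F_def by (rule integral_norm_bound)
    also have "\<dots> \<le> (LINT z|lborel. M * (?I z + (norm (l2_fun u z))\<^sup>2))"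
      by (intro integral_mono integrable_norm int maj dom)
    also have "\<dots> = M * ((d - c) + (norm u)\<^sup>2)"
      using \<open>c \<le> d\<close> by (simp add: Bochner_Integration.integral_add[OF I_int sq] norm_l2_sq)
    finally show ?thesis using True by simp
  next
    case False
    then have "\<kappa> x = (\<lambda>z. 0)" by (auto simp: \<kappa>_def)
    then show ?thesis using False by (simp add: F_def)
  qed
  have F_sq: "(norm (F u x))\<^sup>2 \<le> (M * ((d - c) + (norm u)\<^sup>2))\<^sup>2 * ?I x" for u x
  proof -
    have "(norm (F u x))\<^sup>2 \<le> ((M * ((d - c) + (norm u)\<^sup>2)) * ?I x)\<^sup>2"
      by (intro power_mono F_bound norm_ge_zero)
    also have "\<dots> = (M * ((d - c) + (norm u)\<^sup>2))\<^sup>2 * ?I x"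
      by (cases "x \<in> {c..d}") simp_all
    finally show ?thesis .
  qed
  have FI_int: "integrable lborel (\<lambda>x. (M * ((d - c) + (norm u)\<^sup>2))\<^sup>2 * ?I x)" for u :: "'a l2"
    by (intro integrable_mult_right I_int)
  have F_int: "integrable lborel (\<lambda>x. (norm (F u x))\<^sup>2)" for u
    by (rule Bochner_Integration.integrable_bound[OF FI_int[of u]]) (use F_sq[of u] in auto)
  have si: "square_integrable (F u)" for u
    using F_int by (simp add: square_integrable_def)
  have add: "integral_op c d k (u + v) = integral_op c d k u + integral_op c d k v" for u v
  proof -
    have "F (u + v) x = F u x + F v x" for x
    proof -
      have "F (u + v) x = (LINT z|lborel. \<kappa> x z * l2_fun u z + \<kappa> x z * l2_fun v z)"
        unfolding F_def
        by (intro integral_cong_AE)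
          (measurable, use l2_fun_add[of u v] in eventually_elim, simp add: distrib_left)
      then show ?thesis unfolding F_def by (simp add: int)
    qed
    then have "F (u + v) = (\<lambda>x. F u x + F v x)" by (rule ext)
    then show ?thesis unfolding op by (simp add: l2_of_add si)
  qed
  have scale: "integral_op c d k (r *\<^sub>R u) = r *\<^sub>R integral_op c d k u" for r u
  proof -
    have "F (r *\<^sub>R u) x = r *\<^sub>R F u x" for x
    proof -
      have "F (r *\<^sub>R u) x = (LINT z|lborel. r *\<^sub>R (\<kappa> x z * l2_fun u z))"
        unfolding F_def
        by (intro integral_cong_AE)
          (measurable, use l2_fun_scaleR[of r u] in eventually_elim, simp)
      then show ?thesis unfolding F_def by simp
    qed
    then have "F (r *\<^sub>R u) = (\<lambda>x. r *\<^sub>R F u x)" by (rule ext)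
    then show ?thesis unfolding op by (simp add: l2_of_scaleR si)
  qed
  have mem: "integral_op c d k u \<in> L2 c d" for u
  proof -
    have "F u x = 0" if "x \<notin> {c..d}" for x using F_bound[of u x] that by simp
    with l2_fun_l2_of[OF si[of u]] have
      "AE x in lborel. x \<notin> {c..d} \<longrightarrow> l2_fun (l2_of (F u)) x = 0"
      by (auto elim: eventually_mono)
    then show ?thesis by (simp add: op L2_def)
  qed
  define B where "B = M * ((d - c) + 1) * sqrt (d - c)"
  have unit: "norm (integral_op c d k u) \<le> B" if "norm u \<le> 1" for u
  proof -
    have "(norm (integral_op c d k u))\<^sup>2 = (LINT x|lborel. (norm (F u x))\<^sup>2)"
      unfolding op norm_l2_sq
      by (intro integral_cong_AE) (measurable, use l2_fun_l2_of[OF si[of u]] in eventually_elim, simp)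
    also have "\<dots> \<le> (LINT x|lborel. (M * ((d - c) + (norm u)\<^sup>2))\<^sup>2 * ?I x)"
      by (intro integral_mono F_int FI_int F_sq)
    also have "\<dots> = (M * ((d - c) + (norm u)\<^sup>2))\<^sup>2 * (d - c)" using \<open>c \<le> d\<close> by simp
    also have "\<dots> \<le> (M * ((d - c) + 1))\<^sup>2 * (d - c)"
      using that M(1) \<open>c \<le> d\<close>
      by (intro mult_right_mono power_mono mult_left_mono add_left_mono) (auto simp: power_le_one)
    also have "\<dots> = B\<^sup>2" using \<open>c \<le> d\<close> by (simp add: B_def power_mult_distrib)
    finally show ?thesis by (rule power2_le_imp_le) (use M(1) \<open>c \<le> d\<close> in \<open>simp add: B_def\<close>)
  qed
  have "norm (integral_op c d k u) \<le> B * norm u" for u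
  proof (cases "u = 0")
    case True
    then show ?thesis using scale[of 0 0] by simp
  next
    case False
    then have "norm (integral_op c d k (inverse (norm u) *\<^sub>R u)) \<le> B" by (intro unit) simp
    then show ?thesis using False by (simp add: scale field_simps)
  qed
  with add scale mem show ?thesis unfolding bounded_linear_op_on_def by blast
qed

section \<open>Convergence at the stopping index\<close>

theorem theorem3p7:
  fixes c d \<alpha>0 q C \<epsilon> \<theta> :: real
    and k :: "real \<Rightarrow> real \<Rightarrow> 'a::{real_normed_field,euclidean_space}"
    and H :: "'a l2 set"
    and K Kadj T Q :: "'a l2 \<Rightarrow> 'a l2"
    and Tm Km Qm :: "nat \<Rightarrow> 'a l2 \<Rightarrow> 'a l2"
    and y f :: "'a l2"
    and \<Delta> :: "real set"
    and f\<delta> :: "real \<Rightarrow> 'a l2"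
    and a :: "nat \<Rightarrow> real"
    and m :: "nat \<Rightarrow> nat"
    and G :: "real \<Rightarrow> nat \<Rightarrow> real"
    and u :: "real \<Rightarrow> nat \<Rightarrow> 'a l2"
    and n\<delta> :: "real \<Rightarrow> nat"
  assumes cd: "c < d"
    and smooth: "smooth_kernel c d k"
    and H_def: "H = L2 c d"
    and K_def: "K = integral_op c d k"
    and Kadj_def: "Kadj = adjoint_on H K"
    and T_def: "T = (\<lambda>v. Kadj (K v))"
    and Q_def: "Q = (\<lambda>v. K (Kadj v))"
    and y_in: "y \<in> H" and f_in: "f \<in> H"
    and Ky: "K y = f"
    and y_orth: "\<forall>v \<in> nullspace_on H K. y \<bullet> v = 0"
    and \<Delta>_pos: "\<Delta> \<subseteq> {0<..}"
    and f\<delta>_in: "\<forall>\<delta>\<in>\<Delta>. f\<delta> \<delta> \<in> H"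
    and noise: "\<forall>\<delta>\<in>\<Delta>. norm (f\<delta> \<delta> - f) \<le> \<delta>"
    and q: "0 < q" "q < 1"
    and \<alpha>0: "0 < \<alpha>0"
    and a_def: "a = (\<lambda>n. \<alpha>0 * q ^ n)"
    and Tm_op: "\<forall>j. bounded_linear_op_on H (Tm j) \<and> finite_rank_on H (Tm j)"
    and Km_op: "\<forall>j. bounded_linear_op_on H (Km j) \<and> finite_rank_on H (Km j)"
    and Qm_op: "\<forall>j. bounded_linear_op_on H (Qm j) \<and> finite_rank_on H (Qm j)"
    and Tm_lim: "(\<lambda>j. opnorm_on H (\<lambda>v. Tm j v - T v)) \<longlonglongrightarrow> 0"
    and Km_lim: "(\<lambda>j. opnorm_on H (\<lambda>v. Km j v - Kadj v)) \<longlonglongrightarrow> 0"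
    and \<epsilon>: "0 < \<epsilon>" "\<epsilon> \<le> 1 / 2"
    and m_T: "\<forall>i\<ge>1. opnorm_on H (\<lambda>v. T v - Tm (m i) v) \<le> a i / 2"
    and m_TK: "\<forall>i\<ge>1. opnorm_on H (\<lambda>v. Tm (m i) v - Km (m i) (K v)) \<le> (a i)\<^sup>2"
    and m_K: "\<forall>i\<ge>1. opnorm_on H (\<lambda>v. Km (m i) v - Kadj v) \<le> sqrt (a i) / 2"
    and m_Q: "\<forall>i\<ge>1. opnorm_on H (\<lambda>v. Q v - Qm (m i) v) \<le> \<epsilon> * a i"
    and u_0: "\<forall>\<delta>\<in>\<Delta>. u \<delta> 0 = 0"
    and u_rec: "\<forall>\<delta>\<in>\<Delta>. \<forall>n\<ge>1. u \<delta> n =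
          q *\<^sub>R u \<delta> (n - 1)
          + (1 - q) *\<^sub>R shifted_inv_on H (Tm (m n)) (a n) (Km (m n) (f\<delta> \<delta>))"
    and G_0: "\<forall>\<delta>\<in>\<Delta>. G \<delta> 0 = 0"
    and G_rec: "\<forall>\<delta>\<in>\<Delta>. \<forall>n\<ge>1. G \<delta> n =
          q * G \<delta> (n - 1)
          + (1 - q) * a n * norm (shifted_inv_on H (Qm (m n)) (a n) (f\<delta> \<delta>))"
    and C: "2 < C"
    and \<theta>: "0 < \<theta>" "\<theta> < 1"
    and G_1: "\<forall>\<delta>\<in>\<Delta>. G \<delta> 1 \<ge> C * \<delta> powr \<theta>"
    and n\<delta>_ge: "\<forall>\<delta>\<in>\<Delta>. n\<delta> \<delta> \<ge> 1"
    and stop_at: "\<forall>\<delta>\<in>\<Delta>. G \<delta> (n\<delta> \<delta>) \<le> C * \<delta> powr \<theta>"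
    and stop_before: "\<forall>\<delta>\<in>\<Delta>. \<forall>n. 1 \<le> n \<and> n < n\<delta> \<delta> \<longrightarrow> C * \<delta> powr \<theta> < G \<delta> n"
  shows "((\<lambda>\<delta>. norm (u \<delta> (n\<delta> \<delta>) - y)) \<longlongrightarrow> 0) (at 0 within \<Delta>)"
proof -
  define p where "p = sqrt q"
  have p: "0 < p" "p < 1" and qp: "q = p\<^sup>2" using q by (auto simp: p_def)
  have a_pos: "0 < a n" for n using q \<alpha>0 by (simp add: a_def)
  have a_p: "a n = \<alpha>0 * (p ^ n)\<^sup>2" for n
    by (simp add: a_def qp power_mult[symmetric] mult.commute)
  have sqrt_a: "sqrt (a n) = sqrt \<alpha>0 * p ^ n" for n
    using p by (simp add: a_p real_sqrt_mult)
  have a_le: "a n \<le> \<alpha>0 * p ^ n" for n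
    unfolding a_p using p \<alpha>0 by (intro mult_left_mono) (auto simp: power2_eq_square mult_le_cancel_left1 power_le_one)
  have S: "subspace H" "complete H" unfolding H_def by (rule subspace_L2 complete_L2)+
  have "continuous_on ({c..d} \<times> {c..d}) (\<lambda>(x, z). k x z)"
    using smooth unfolding smooth_kernel_def by blast
  then have K: "bounded_linear_op_on H K"
    unfolding H_def K_def using cd by (intro bounded_linear_op_on_integral_op) auto
  have Ks: "bounded_linear_op_on H Kadj"
    unfolding Kadj_def by (rule bounded_linear_op_on_adjoint[OF S K])
  have adj: "K v \<bullet> w = v \<bullet> Kadj w" if "v \<in> H" "w \<in> H" for v w
    unfolding Kadj_def using adjoint_on_inner[OF S K that(2,1)] .
  have T: "bounded_linear_op_on H T"
    unfolding T_def by (rule bounded_linear_op_on_compose[OF Ks K])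
  have Q: "bounded_linear_op_on H Q"
    unfolding Q_def by (rule bounded_linear_op_on_compose[OF K Ks])
  note near = opnorm_on_bound[OF S(1) bounded_linear_op_on_minus[OF S(1)]]
  have near_T: "norm (Kadj (K v) - Tm (m i) v) \<le> a i / 2 * norm v" if "i \<ge> 1" "v \<in> H" for i v
    using near[OF T, of "Tm (m i)" "a i / 2" v] Tm_op m_T that by (simp add: T_def)
  have near_LK: "norm (Tm (m i) v - Km (m i) (K v)) \<le> (a i)\<^sup>2 * norm v" if "i \<ge> 1" "v \<in> H" for i v
  proof (rule near[of "Tm (m i)" "\<lambda>v. Km (m i) (K v)"])
    show "bounded_linear_op_on H (Tm (m i))" using Tm_op by blast
    show "bounded_linear_op_on H (\<lambda>v. Km (m i) (K v))"
      using Km_op bounded_linear_op_on_compose[of H "Km (m i)" K] K by blast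
    show "opnorm_on H (\<lambda>v. Tm (m i) v - Km (m i) (K v)) \<le> (a i)\<^sup>2" using m_TK that by blast
    show "v \<in> H" by fact
  qed
  have near_Ks: "norm (Km (m i) v - Kadj v) \<le> sqrt (a i) / 2 * norm v" if "i \<ge> 1" "v \<in> H" for i v
    using near[OF _ Ks, of "Km (m i)" "sqrt (a i) / 2" v] Km_op m_K that by blast
  have near_Q: "norm (K (Kadj v) - Qm (m i) v) \<le> a i / 2 * norm v" if "i \<ge> 1" "v \<in> H" for i v
  proof -
    have "opnorm_on H (\<lambda>v. Q v - Qm (m i) v) \<le> \<epsilon> * a i" using m_Q that by blast
    also have "\<dots> \<le> a i / 2" using \<epsilon> a_pos[of i] by (simp add: mult_right_mono[of \<epsilon> "1/2"])
    finally show ?thesis using near[OF Q, of "Qm (m i)" "a i / 2" v] Qm_op that by (simp add: Q_def)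
  qed
  have noise': "norm (f\<delta> \<delta> - K y) \<le> \<delta>" if "\<delta> \<in> \<Delta>" for \<delta> using noise that Ky by simp

  have u_err: "norm (u \<delta> n - y) \<le> 2 * norm (y - Kadj (K z))
      + (norm y + 2 * (\<alpha>0 * (2 * norm y + 4 * norm z))) * p ^ n + (2 * \<delta> / sqrt \<alpha>0) / p ^ n"
    if \<delta>: "\<delta> \<in> \<Delta>" and z: "z \<in> H" for \<delta> z n
  proof (rule geometric_average_bound[OF p])
    show "0 \<le> 2 * \<delta> / sqrt \<alpha>0" using \<delta> \<Delta>_pos \<alpha>0 by auto
    show "u \<delta> 0 = 0" using u_0 \<delta> by blast
    show "u \<delta> n = p\<^sup>2 *\<^sub>R u \<delta> (n - 1)
        + (1 - p\<^sup>2) *\<^sub>R shifted_inv_on H (Tm (m n)) (a n) (Km (m n) (f\<delta> \<delta>))" if "n \<ge> 1" for n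
      using u_rec \<delta> that by (simp add: qp)
    show "norm (shifted_inv_on H (Tm (m n)) (a n) (Km (m n) (f\<delta> \<delta>)) - y)
        \<le> 2 * norm (y - Kadj (K z)) + \<alpha>0 * (2 * norm y + 4 * norm z) * p ^ n
          + 2 * \<delta> / sqrt \<alpha>0 / p ^ n" if n: "n \<ge> 1" for n
    proof -
      have "norm (shifted_inv_on H (Tm (m n)) (a n) (Km (m n) (f\<delta> \<delta>)) - y)
          \<le> 2 * \<delta> / sqrt (a n) + a n * (2 * norm y + 4 * norm z) + 2 * norm (y - Kadj (K z))"
        using Tm_op Km_op y_in f\<delta>_in \<delta> z near_T[OF n] near_LK[OF n] near_Ks[OF n]
        by (intro perturbed_tikhonov_error[OF S(1) K Ks adj] a_pos noise') auto
      moreover have "a n * (2 * norm y + 4 * norm z) \<le> \<alpha>0 * p ^ n * (2 * norm y + 4 * norm z)"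
        by (intro mult_right_mono a_le) auto
      ultimately show ?thesis by (simp add: sqrt_a algebra_simps)
    qed
  qed (use \<alpha>0 in auto)

  have G_upper: "G \<delta> n \<le> 2 * \<delta> + (2 * (sqrt \<alpha>0 * norm y)) * p ^ n" if \<delta>: "\<delta> \<in> \<Delta>" for \<delta> n
  proof -
    have "norm (G \<delta> n - 0) \<le> 2 * \<delta> + (norm (0::real) + 2 * (sqrt \<alpha>0 * norm y)) * p ^ n + 0 / p ^ n"
    proof (rule geometric_average_bound[OF p])
      show "0 \<le> 2 * \<delta>" using \<delta> \<Delta>_pos by auto
      show "G \<delta> 0 = 0" using G_0 \<delta> by blast
      show "G \<delta> n = p\<^sup>2 *\<^sub>R G \<delta> (n - 1)
          + (1 - p\<^sup>2) *\<^sub>R (a n * norm (shifted_inv_on H (Qm (m n)) (a n) (f\<delta> \<delta>)))" if "n \<ge> 1" for n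
        using G_rec \<delta> that by (simp add: qp)
      show "norm (a n * norm (shifted_inv_on H (Qm (m n)) (a n) (f\<delta> \<delta>)) - 0)
          \<le> 2 * \<delta> + sqrt \<alpha>0 * norm y * p ^ n + 0 / p ^ n" if n: "n \<ge> 1" for n
      proof -
        have "a n * norm (shifted_inv_on H (Qm (m n)) (a n) (f\<delta> \<delta>)) \<le> 2 * \<delta> + sqrt (a n) * norm y"
          using Qm_op y_in f\<delta>_in \<delta> near_Q[OF n]
          by (intro perturbed_residual_bound[OF S(1) K Ks adj] a_pos noise') auto
        then show ?thesis using a_pos[of n] by (simp add: sqrt_a algebra_simps)
      qed
    qed (use \<alpha>0 in auto)
    then show ?thesis by simp
  qed

  have noise_lim: "((\<lambda>\<delta>. \<delta> / p ^ n\<delta> \<delta>) \<longlongrightarrow> 0) (at 0 within \<Delta>)"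
    using G_upper G_1 stop_before \<alpha>0
    by (intro stopping_noise_tendsto_0[OF \<Delta>_pos p C \<theta>, of "2 * (sqrt \<alpha>0 * norm y)" G]) auto

  have index_lim: "((\<lambda>\<delta>. p ^ n\<delta> \<delta>) \<longlongrightarrow> 0) (at 0 within \<Delta>)" if "y \<noteq> 0"
  proof -
    have "f \<noteq> 0"
    proof
      assume "f = 0"
      then have "y \<in> nullspace_on H K" using y_in Ky by (simp add: nullspace_on_def)
      then show False using y_orth \<open>y \<noteq> 0\<close> by fastforce
    qed
    obtain B where B: "B > 0" "\<And>v. v \<in> H \<Longrightarrow> norm (Qm (m 1) v) \<le> B * norm v"
      using bounded_linear_op_on_bound Qm_op by metis
    define \<kappa> where "\<kappa> = (1 - q) * a 1 / (B + a 1)"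
    have \<kappa>: "\<kappa> > 0" using q B a_pos[of 1] by (simp add: \<kappa>_def)
    have G1: "\<kappa> * norm (f\<delta> \<delta>) \<le> G \<delta> 1" if \<delta>: "\<delta> \<in> \<Delta>" for \<delta>
    proof -
      define x where "x = shifted_inv_on H (Qm (m 1)) (a 1) (f\<delta> \<delta>)"
      have pos: "0 \<le> K (Kadj v) \<bullet> v" if "v \<in> H" for v
        using adj[of "Kadj v" v] that bounded_linear_op_onD(1)[OF Ks] by simp
      have op: "bounded_linear_op_on H (Qm (m 1))" "finite_rank_on H (Qm (m 1))" "f\<delta> \<delta> \<in> H"
        using Qm_op f\<delta>_in \<delta> by auto
      have x: "x \<in> H" "Qm (m 1) x + a 1 *\<^sub>R x = f\<delta> \<delta>"
        unfolding x_def
        using shifted_inv_on_solution[of H "Qm (m 1)" "a 1" "\<lambda>v. K (Kadj v)",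
            OF S(1) op(1,2) a_pos pos near_Q[of 1] op(3)] by simp_all
      have "norm (f\<delta> \<delta>) \<le> norm (Qm (m 1) x) + a 1 * norm x"
        unfolding x(2)[symmetric] using norm_triangle_ineq[of "Qm (m 1) x" "a 1 *\<^sub>R x"] a_pos[of 1]
        by simp
      also have "\<dots> \<le> (B + a 1) * norm x" using B(2)[OF x(1)] by (simp add: distrib_right)
      finally have "\<kappa> * norm (f\<delta> \<delta>) \<le> \<kappa> * ((B + a 1) * norm x)"
        using \<kappa> by (intro mult_left_mono) auto
      also have "\<dots> = (1 - q) * a 1 * norm x" using B a_pos[of 1] by (simp add: \<kappa>_def)
      also have "\<dots> = G \<delta> 1" using G_rec G_0 \<delta> by (simp add: x_def)
      finally show ?thesis .
    qed
    have "\<forall>\<^sub>F \<delta> in at 0 within \<Delta>. \<delta> \<in> \<Delta> \<and> \<delta> < norm f / 2"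
      unfolding eventually_at using \<open>f \<noteq> 0\<close>
      by (intro exI[of _ "norm f / 2"]) (auto simp: dist_real_def)
    then have "\<forall>\<^sub>F \<delta> in at 0 within \<Delta>. \<kappa> * (norm f / 2) \<le> G \<delta> 1"
    proof eventually_elim
      case (elim \<delta>)
      then have "norm f / 2 \<le> norm (f\<delta> \<delta>)"
        using noise norm_triangle_ineq2[of f "f\<delta> \<delta>"] by (auto simp: norm_minus_commute dest!: bspec)
      then have "\<kappa> * (norm f / 2) \<le> \<kappa> * norm (f\<delta> \<delta>)" using \<kappa> by (intro mult_left_mono) auto
      then show ?case using G1 elim by fastforce
    qed
    moreover have "p\<^sup>2 * G \<delta> n \<le> G \<delta> (Suc n)" if "\<delta> \<in> \<Delta>" for \<delta> n
      using G_rec that q a_pos[of "Suc n"] by (simp add: qp)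
    ultimately show ?thesis
      using \<kappa> \<open>f \<noteq> 0\<close> n\<delta>_ge stop_at C
      by (intro stopping_index_power_tendsto_0[OF \<Delta>_pos p _ \<theta>(1),
            where c = "\<kappa> * (norm f / 2)" and G = G and C = C]) auto
  qed

  have in_\<Delta>: "\<forall>\<^sub>F \<delta> in at 0 within \<Delta>. \<delta> \<in> \<Delta>" by (simp add: eventually_at_filter)
  show ?thesis
  proof (rule tendstoI)
    fix e :: real assume e: "e > 0"
    \<comment> \<open>For \<open>y = 0\<close> the index limit is not available, so \<open>z = 0\<close> is chosen to make \<open>c\<^sub>z\<close> vanish.\<close>
    obtain z where z: "z \<in> H" "norm (y - Kadj (K z)) < e / 4" and z0: "y = 0 \<longrightarrow> z = 0"
    proof (cases "y = 0")
      case True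
      have "K 0 = 0" "Kadj 0 = 0"
        using bounded_linear_op_onD(3)[OF K y_in, of 0] bounded_linear_op_onD(3)[OF Ks y_in, of 0]
        by simp_all
      then show ?thesis using that[of 0] True subspace_0[OF S(1)] e by simp
    next
      case False
      show ?thesis
        using orthogonal_to_nullspace_approx[OF S K y_in y_orth, of "e / 4"] e False that
        unfolding Kadj_def by auto
    qed
    define c\<^sub>z where "c\<^sub>z = norm y + 2 * (\<alpha>0 * (2 * norm y + 4 * norm z))"
    have "((\<lambda>\<delta>. c\<^sub>z * p ^ n\<delta> \<delta>) \<longlongrightarrow> 0) (at 0 within \<Delta>)"
    proof (cases "y = 0")
      case True
      then show ?thesis using z0 by (simp add: c\<^sub>z_def)
    next
      case False
      then show ?thesis using tendsto_mult_right_zero[OF index_lim] by blast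
    qed
    moreover have "((\<lambda>\<delta>. 2 / sqrt \<alpha>0 * (\<delta> / p ^ n\<delta> \<delta>)) \<longlongrightarrow> 0) (at 0 within \<Delta>)"
      by (rule tendsto_mult_right_zero[OF noise_lim])
    ultimately have "((\<lambda>\<delta>. c\<^sub>z * p ^ n\<delta> \<delta> + 2 / sqrt \<alpha>0 * (\<delta> / p ^ n\<delta> \<delta>)) \<longlongrightarrow> 0)
        (at 0 within \<Delta>)"
      by (rule tendsto_add_zero)
    then have "\<forall>\<^sub>F \<delta> in at 0 within \<Delta>.
        c\<^sub>z * p ^ n\<delta> \<delta> + 2 / sqrt \<alpha>0 * (\<delta> / p ^ n\<delta> \<delta>) < e / 2"
      using e by (intro order_tendstoD(2)) auto
    with in_\<Delta> show "\<forall>\<^sub>F \<delta> in at 0 within \<Delta>. dist (norm (u \<delta> (n\<delta> \<delta>) - y)) 0 < e"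
    proof eventually_elim
      case (elim \<delta>)
      then show ?case using u_err[OF elim(1) z(1), of "n\<delta> \<delta>"] z(2)
        by (simp add: c\<^sub>z_def)
    qed
  qed
qed

end
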